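(* There exists an absolute constant $C$ such that for every integer $m>C$ there is no primitive regular ternary $m$-gonal form $\triangle_{m,(a,b,c)}$ with $(a,b,c)\in\mathbb{N}^3$.
   Context: For an integer $m\ge 3$ and $x\in\mathbb{Z}$, $p_m(x):=((m-2)x^2-(m-4)x)/2$ is the $x$-th generalized $m$-gonal number. For $a_1,\dots,a_n\in\mathbb{N}$ the $m$-gonal form is $\triangle_{m,(a_1,\dots,a_n)}(x_1,\dots,x_n):=\sum_{i=1}^n a_i p_m(x_i)$; it is ternary when $n=3$ and primitive when $\gcd(a_1,\dots,a_n)=1$. For a ring $R$, a rational number $\ell$ is represented by a polynomial $f$ over $R$ if $f(x)=\ell$ has a solution $x\in R^n$. $\ell$ is locally represented by $f$ if it is represented over $\mathbb{Z}_p$ for every prime $p$ and over $\mathbb{R}$; it is globally represented if it is represented over $\mathbb{Z}$. A quadratic polynomial $f$ is regular if it globally represents every rational number that it locally represents. *)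

theory Defs
  imports Complex_Main "HOL-Computational_Algebra.Primes" "HOL-Algebra.Algebraic_Closure_Type"
begin

section \<open>The field of \<open>p\<close>-adic numbers\<close>

definition padic_abs :: "nat \<Rightarrow> rat \<Rightarrow> real" where
  "padic_abs p x =
     (if x = 0 then 0
      else real p powi (int (multiplicity (int p) (snd (quotient_of x)))
                        - int (multiplicity (int p) (fst (quotient_of x)))))"

definition padic_Cauchy :: "nat \<Rightarrow> (nat \<Rightarrow> rat) \<Rightarrow> bool" where
  "padic_Cauchy p s \<longleftrightarrow> (\<forall>e>0. \<exists>N. \<forall>i\<ge>N. \<forall>j\<ge>N. padic_abs p (s i - s j) < e)"

definition padic_null :: "nat \<Rightarrow> (nat \<Rightarrow> rat) set" where
  "padic_null p = {s. (\<lambda>n. padic_abs p (s n)) \<longlonglongrightarrow> 0}"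

definition padic_Cauchy_ring :: "nat \<Rightarrow> (nat \<Rightarrow> rat) ring" where
  "padic_Cauchy_ring p =
     \<lparr>carrier = {s. padic_Cauchy p s},
      monoid.mult = (\<lambda>s t n. s n * t n), one = (\<lambda>_. 1),
      ring.zero = (\<lambda>_. 0), add = (\<lambda>s t n. s n + t n)\<rparr>"

definition padic_field :: "nat \<Rightarrow> (nat \<Rightarrow> rat) set ring" where
  "padic_field p = padic_Cauchy_ring p Quot padic_null p"

text \<open>The absolute value of the class of \<open>s\<close> is the limit of the absolute values of the \<open>s n\<close>;
  it does not depend on the representative.\<close>

definition padic_integers :: "nat \<Rightarrow> (nat \<Rightarrow> rat) set set" where
  "padic_integers p =
     {x \<in> carrier (padic_field p). \<forall>s\<in>x. lim (\<lambda>n. padic_abs p (s n)) \<le> 1}"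

section \<open>Generalized polygonal numbers and \<open>m\<close>-gonal forms\<close>

text \<open>An equation over a ring \<open>R\<close> is evaluated in a field \<open>K\<close> of characteristic zero that contains
  \<open>R\<close>, because both the coefficients of the form and the represented number are rational.
  The function \<open>rat_in K\<close> is the canonical embedding of the rationals into \<open>K\<close>.\<close>

definition rat_in :: "('k, 'b) ring_scheme \<Rightarrow> rat \<Rightarrow> 'k" where
  "rat_in K q = [fst (quotient_of q)] \<cdot>\<^bsub>K\<^esub> \<one>\<^bsub>K\<^esub> \<otimes>\<^bsub>K\<^esub> inv\<^bsub>K\<^esub> ([snd (quotient_of q)] \<cdot>\<^bsub>K\<^esub> \<one>\<^bsub>K\<^esub>)"

definition gonal_number :: "('k, 'b) ring_scheme \<Rightarrow> int \<Rightarrow> 'k \<Rightarrow> 'k" where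
  "gonal_number K m x =
     rat_in K (1 / 2) \<otimes>\<^bsub>K\<^esub>
       (rat_in K (of_int (m - 2)) \<otimes>\<^bsub>K\<^esub> x [^]\<^bsub>K\<^esub> (2::nat) \<ominus>\<^bsub>K\<^esub> rat_in K (of_int (m - 4)) \<otimes>\<^bsub>K\<^esub> x)"

definition gonal_form :: "('k, 'b) ring_scheme \<Rightarrow> int \<Rightarrow> nat list \<Rightarrow> (nat \<Rightarrow> 'k) \<Rightarrow> 'k" where
  "gonal_form K m as x =
     (\<Oplus>\<^bsub>K\<^esub>i\<in>{..<length as}. rat_in K (of_nat (as ! i)) \<otimes>\<^bsub>K\<^esub> gonal_number K m (x i))"

definition primitive_form :: "nat list \<Rightarrow> bool" where
  "primitive_form as \<longleftrightarrow> Gcd (set as) = 1"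

definition represented_over ::
  "('k, 'b) ring_scheme \<Rightarrow> 'k set \<Rightarrow> int \<Rightarrow> nat list \<Rightarrow> rat \<Rightarrow> bool" where
  "represented_over K R m as l \<longleftrightarrow>
     (\<exists>x \<in> {..<length as} \<rightarrow> R. gonal_form K m as x = rat_in K l)"

definition globally_represented :: "int \<Rightarrow> nat list \<Rightarrow> rat \<Rightarrow> bool" where
  "globally_represented m as l \<longleftrightarrow>
     represented_over (ring_of_type_algebra :: rat ring) \<int> m as l"

definition locally_represented :: "int \<Rightarrow> nat list \<Rightarrow> rat \<Rightarrow> bool" where
  "locally_represented m as l \<longleftrightarrow>
     (\<forall>p. prime p \<longrightarrow> represented_over (padic_field p) (padic_integers p) m as l) \<and>
     represented_over (ring_of_type_algebra :: real ring) UNIV m as l"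

definition regular_form :: "int \<Rightarrow> nat list \<Rightarrow> bool" where
  "regular_form m as \<longleftrightarrow> (\<forall>l. locally_represented m as l \<longrightarrow> globally_represented m as l)"

section \<open>\<open>padic_field p\<close> is a field, and \<open>rat_in\<close> embeds the rationals into it\<close>

lemma padic_abs_frac:
  assumes "prime p" "a \<noteq> 0" "b \<noteq> 0"
  shows "padic_abs p (of_int a / of_int b) = real p powi (int (multiplicity (int p) b) - int (multiplicity (int p) a))"
proof -
  let ?x = "of_int a / of_int b :: rat"
  obtain c d where cd: "quotient_of ?x = (c,d)" by fastforce
  have d: "d > 0" using quotient_of_denom_pos cd by blast
  have x: "?x = of_int c / of_int d" using quotient_of_div cd by blast
  have "c \<noteq> 0" using x assms d by auto
  have "of_int (a * d) = (of_int (c * b) :: rat)" using x assms d by (simp add: field_simps)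
  hence e: "a * d = c * b" using of_int_eq_iff by blast
  have pr: "prime_elem (int p)" using assms by simp
  have "multiplicity (int p) a + multiplicity (int p) d = multiplicity (int p) c + multiplicity (int p) b"
    using prime_elem_multiplicity_mult_distrib[OF pr] e assms d \<open>c \<noteq> 0\<close>
    by (metis less_irrefl)
  thus ?thesis using cd assms by (auto simp: padic_abs_def intro!: arg_cong[where f="\<lambda>k. real p powi k"])
qed

lemma rat_fracE: obtains a b where "(x::rat) = of_int a / of_int b" "b \<noteq> 0"
  by (metis quotient_of_div quotient_of_denom_pos surj_pair less_irrefl)

lemma padic_abs_0[simp]: "padic_abs p 0 = 0" by (simp add: padic_abs_def)
lemma padic_abs_nonneg: "padic_abs p x \<ge> 0" by (simp add: padic_abs_def)

lemma padic_abs_pos: assumes "prime p" "x \<noteq> 0" shows "padic_abs p x > 0"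
  using assms prime_gt_0_nat[of p] by (auto simp: padic_abs_def intro!: zero_less_power_int)

lemma padic_abs_mult: assumes "prime p" shows "padic_abs p (x * y) = padic_abs p x * padic_abs p y"
proof (cases "x = 0 \<or> y = 0")
  case False
  obtain a b where x: "x = of_int a / of_int b" "b \<noteq> 0" by (rule rat_fracE)
  obtain c d where y: "y = of_int c / of_int d" "d \<noteq> 0" by (rule rat_fracE)
  have ac: "a \<noteq> 0" "c \<noteq> 0" using False x y by auto
  have xy: "x * y = of_int (a*c) / of_int (b*d)" using x y by simp
  have pr: "prime_elem (int p)" using assms by simp
  have p0: "real p \<noteq> 0" using assms prime_gt_0_nat[of p] by simp
  have "a*c \<noteq> 0" "b*d \<noteq> 0" using ac x y by auto
  show ?thesis unfolding xy padic_abs_frac[OF assms \<open>a*c \<noteq> 0\<close> \<open>b*d \<noteq> 0\<close>]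
    unfolding x(1) y(1) padic_abs_frac[OF assms ac(1) x(2)] padic_abs_frac[OF assms ac(2) y(2)]
    using p0 ac x y by (simp add: prime_elem_multiplicity_mult_distrib[OF pr] power_int_add[symmetric] algebra_simps)
qed auto

lemma padic_abs_ultra:
  assumes "prime p"
  shows "padic_abs p (x + y) \<le> max (padic_abs p x) (padic_abs p y)"
proof (cases "x = 0 \<or> y = 0 \<or> x + y = 0")
  case True thus ?thesis using padic_abs_nonneg by (auto simp: max_def)
next
  case False
  obtain a b where x: "x = of_int a / of_int b" "b \<noteq> 0" by (rule rat_fracE)
  obtain c d where y: "y = of_int c / of_int d" "d \<noteq> 0" by (rule rat_fracE)
  have x': "x = of_int (a*d) / of_int (b*d)" using x y by simp
  have y': "y = of_int (b*c) / of_int (b*d)" using x y by simp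
  have xy: "x + y = of_int (a*d+b*c) / of_int (b*d)" using x y by (simp add: field_simps)
  have nz: "a*d \<noteq> 0" "b*c \<noteq> 0" "b*d \<noteq> 0" "a*d+b*c \<noteq> 0"
    using False x' y' xy x y by (auto simp del: of_int_mult of_int_add)
  let ?m = "multiplicity (int p)"
  have p1: "real p > 1" using assms prime_gt_1_nat[of p] by simp
  have "?m (a*d+b*c) \<ge> min (?m (a*d)) (?m (b*c))"
  proof (rule multiplicity_geI)
    show "\<not> is_unit (int p)" using p1 by simp
    show "int p ^ min (?m (a*d)) (?m (b*c)) dvd a*d+b*c"
      by (intro dvd_add multiplicity_dvd') auto
  qed (use nz in auto)
  hence h: "?m (a*d) \<le> ?m (a*d+b*c) \<or> ?m (b*c) \<le> ?m (a*d+b*c)" by linarith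
  show ?thesis unfolding xy padic_abs_frac[OF assms nz(4) nz(3)]
    unfolding x' y' padic_abs_frac[OF assms nz(1) nz(3)] padic_abs_frac[OF assms nz(2) nz(3)]
    using h p1 by (auto simp: le_max_iff_disj intro: power_int_increasing)
qed

lemma padic_abs_minus: assumes "prime p" shows "padic_abs p (- x) = padic_abs p x"
proof -
  have "padic_abs p (-1) * padic_abs p (-1) = padic_abs p 1" using padic_abs_mult[OF assms, of "-1" "-1"] by simp
  moreover have "padic_abs p 1 = 1" by (simp add: padic_abs_def)
  ultimately have "padic_abs p (-1) = 1" using padic_abs_nonneg[of p "-1"]
    by (metis mult_cancel_right1 power2_eq_square power2_eq_1_iff le_minus_one_simps(3) zero_neq_one)
  thus ?thesis using padic_abs_mult[OF assms, of "-1" x] by simp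
qed

lemma padic_abs_1[simp]: "padic_abs p 1 = 1" by (simp add: padic_abs_def)

lemma padic_abs_add_le: "prime p \<Longrightarrow> padic_abs p (x + y) \<le> padic_abs p x + padic_abs p y"
  using padic_abs_ultra[of p x y] padic_abs_nonneg[of p x] padic_abs_nonneg[of p y] by linarith

lemma padic_abs_diff_le: "prime p \<Longrightarrow> padic_abs p (x - y) \<le> padic_abs p x + padic_abs p y"
  using padic_abs_add_le[of p x "-y"] padic_abs_minus[of p y] by simp

lemma padic_abs_abs_diff:
  assumes "prime p"
  shows "\<bar>padic_abs p x - padic_abs p y\<bar> \<le> padic_abs p (x - y)"
  using padic_abs_add_le[OF assms, of "x-y" y] padic_abs_add_le[OF assms, of "y-x" x] padic_abs_minus[OF assms, of "x-y"]
  by simp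

lemma padic_Cauchy_abs:
  assumes "prime p" "padic_Cauchy p s"
  shows "Cauchy (\<lambda>n. padic_abs p (s n))"
  unfolding Cauchy_def dist_real_def
  using assms(2) padic_abs_abs_diff[OF assms(1)] unfolding padic_Cauchy_def by (meson le_less_trans)

lemma padic_Cauchy_bdd: assumes "prime p" "padic_Cauchy p s" obtains B where "B > 0" "\<And>n. padic_abs p (s n) \<le> B"
proof -
  have "Bseq (\<lambda>n. padic_abs p (s n))" using padic_Cauchy_abs[OF assms] Cauchy_Bseq by blast
  then obtain B where "B>0" "\<forall>n. norm (padic_abs p (s n)) \<le> B" by (auto simp: Bseq_def)
  thus ?thesis using that by (metis real_norm_def abs_le_D1)
qed

lemma padic_Cauchy_add:
  assumes "prime p" "padic_Cauchy p s" "padic_Cauchy p t"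
  shows "padic_Cauchy p (\<lambda>n. s n + t n)"
  unfolding padic_Cauchy_def
proof (intro allI impI)
  fix e::real assume e: "e > 0"
  then obtain M N where M: "\<forall>i\<ge>M. \<forall>j\<ge>M. padic_abs p (s i - s j) < e/2" and N: "\<forall>i\<ge>N. \<forall>j\<ge>N. padic_abs p (t i - t j) < e/2"
    using assms unfolding padic_Cauchy_def by (meson half_gt_zero)
  have "padic_abs p (s i + t i - (s j + t j)) < e" if "i \<ge> max M N" "j \<ge> max M N" for i j
  proof -
    have "padic_abs p (s i - s j) < e/2" "padic_abs p (t i - t j) < e/2" using M N that by auto
    thus ?thesis using padic_abs_add_le[OF assms(1), of "s i - s j" "t i - t j"] by (simp add: algebra_simps)
  qed
  thus "\<exists>N. \<forall>i\<ge>N. \<forall>j\<ge>N. padic_abs p (s i + t i - (s j + t j)) < e" by blast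
qed

lemma padic_Cauchy_mult:
  assumes "prime p" "padic_Cauchy p s" "padic_Cauchy p t"
  shows "padic_Cauchy p (\<lambda>n. s n * t n)"
  unfolding padic_Cauchy_def
proof (intro allI impI)
  fix e::real assume e: "e > 0"
  obtain A where A: "A > 0" "\<And>n. padic_abs p (s n) \<le> A" using padic_Cauchy_bdd assms by blast
  obtain B where B: "B > 0" "\<And>n. padic_abs p (t n) \<le> B" using padic_Cauchy_bdd assms by blast
  have "e/(2*B) > 0" "e/(2*A) > 0" using e A B by auto
  then obtain M N where M: "\<forall>i\<ge>M. \<forall>j\<ge>M. padic_abs p (s i - s j) < e/(2*B)" and N: "\<forall>i\<ge>N. \<forall>j\<ge>N. padic_abs p (t i - t j) < e/(2*A)"
    using assms unfolding padic_Cauchy_def by meson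
  have "padic_abs p (s i * t i - s j * t j) < e" if "i \<ge> max M N" "j \<ge> max M N" for i j
  proof -
    have 1: "padic_abs p (s i - s j) < e/(2*B)" "padic_abs p (t i - t j) < e/(2*A)" using M N that by auto
    have "s i * t i - s j * t j = (s i - s j) * t i + s j * (t i - t j)" by (simp add: algebra_simps)
    hence "padic_abs p (s i * t i - s j * t j) \<le> padic_abs p (s i - s j) * padic_abs p (t i) + padic_abs p (s j) * padic_abs p (t i - t j)"
      using padic_abs_add_le[OF assms(1)] padic_abs_mult[OF assms(1)] by metis
    also have "\<dots> \<le> padic_abs p (s i - s j) * B + A * padic_abs p (t i - t j)"
      using A B padic_abs_nonneg by (intro add_mono mult_left_mono mult_right_mono) auto
    also have "\<dots> < e/(2*B) * B + A * (e/(2*A))" using 1 A B by (intro add_strict_mono mult_strict_left_mono mult_strict_right_mono) auto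
    also have "\<dots> = e" using A B by (simp add: field_simps)
    finally show ?thesis .
  qed
  thus "\<exists>N. \<forall>i\<ge>N. \<forall>j\<ge>N. padic_abs p (s i * t i - s j * t j) < e" by blast
qed

lemma padic_Cauchy_const[simp]: "padic_Cauchy p (\<lambda>_. c)" by (auto simp: padic_Cauchy_def)
lemma padic_Cauchy_minus: "prime p \<Longrightarrow> padic_Cauchy p s \<Longrightarrow> padic_Cauchy p (\<lambda>n. - s n)"
  using padic_Cauchy_mult[of p "\<lambda>_. -1" s] by simp

lemma padic_Cauchy_cring: assumes "prime p" shows "cring (padic_Cauchy_ring p)"
proof (intro cringI abelian_groupI comm_monoidI)
  fix x assume "x \<in> carrier (padic_Cauchy_ring p)"
  thus "\<exists>y\<in>carrier (padic_Cauchy_ring p). y \<oplus>\<^bsub>padic_Cauchy_ring p\<^esub> x = \<zero>\<^bsub>padic_Cauchy_ring p\<^esub>"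
    by (intro bexI[of _ "\<lambda>n. - x n"]) (auto simp: padic_Cauchy_ring_def padic_Cauchy_minus[OF assms])
qed (auto simp: padic_Cauchy_ring_def padic_Cauchy_add[OF assms] padic_Cauchy_mult[OF assms] algebra_simps)

lemma padic_null_Cauchy: assumes "prime p" "s \<in> padic_null p" shows "padic_Cauchy p s"
  unfolding padic_Cauchy_def
proof (intro allI impI)
  fix e::real assume "e > 0"
  then obtain N where N: "\<And>n. n \<ge> N \<Longrightarrow> padic_abs p (s n) < e/2"
    using order_tendstoD(2)[of "\<lambda>n. padic_abs p (s n)" 0 sequentially "e/2"] assms(2)
    unfolding padic_null_def eventually_sequentially by auto
  show "\<exists>N. \<forall>i\<ge>N. \<forall>j\<ge>N. padic_abs p (s i - s j) < e"
    using padic_abs_diff_le[OF assms(1)] N by (intro exI[of _ N]) (smt (verit) field_sum_of_halves)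
qed

lemma padic_null_boundedI:
  assumes "f \<longlonglongrightarrow> 0" "\<And>n. padic_abs p (s n) \<le> f n"
  shows "s \<in> padic_null p"
  unfolding padic_null_def mem_Collect_eq
  by (rule tendsto_sandwich[OF _ _ tendsto_const assms(1)]) (simp_all add: padic_abs_nonneg assms(2))

lemma padic_null_add:
  assumes "prime p" "s \<in> padic_null p" "t \<in> padic_null p"
  shows "(\<lambda>n. s n + t n) \<in> padic_null p"
proof -
  have "(\<lambda>n. padic_abs p (s n) + padic_abs p (t n)) \<longlonglongrightarrow> 0 + 0" using assms unfolding padic_null_def by (intro tendsto_add) auto
  thus ?thesis by (intro padic_null_boundedI[OF _ padic_abs_add_le[OF assms(1)]]) simp
qed

lemma padic_null_mult:
  assumes "prime p" "s \<in> padic_null p" "padic_Cauchy p t"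
  shows "(\<lambda>n. s n * t n) \<in> padic_null p"
proof -
  obtain B where B: "B > 0" "\<And>n. padic_abs p (t n) \<le> B" using padic_Cauchy_bdd assms by blast
  have "(\<lambda>n. padic_abs p (s n) * B) \<longlonglongrightarrow> 0 * B" using assms unfolding padic_null_def by (intro tendsto_mult) auto
  moreover have "padic_abs p (s n * t n) \<le> padic_abs p (s n) * B" for n
    using B by (simp add: padic_abs_mult[OF assms(1)] mult_left_mono padic_abs_nonneg)
  ultimately show ?thesis by (intro padic_null_boundedI[of "\<lambda>n. padic_abs p (s n) * B"]) simp_all
qed

lemma padic_null_ideal: assumes "prime p" shows "ideal (padic_null p) (padic_Cauchy_ring p)"
proof -
  interpret cring "padic_Cauchy_ring p" by (rule padic_Cauchy_cring[OF assms])
  have neg: "\<ominus>\<^bsub>padic_Cauchy_ring p\<^esub> s = (\<lambda>n. - s n)" if "s \<in> carrier (padic_Cauchy_ring p)" for s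
    using that by (intro minus_equality) (auto simp: padic_Cauchy_ring_def padic_Cauchy_minus[OF assms])
  show ?thesis
  proof (rule idealI)
    show "subgroup (padic_null p) (add_monoid (padic_Cauchy_ring p))"
    proof (unfold_locales, goal_cases)
      case 1 show ?case using padic_null_Cauchy[OF assms] by (auto simp: padic_Cauchy_ring_def)
    next
      case (2 x y) thus ?case using padic_null_add[OF assms] by (auto simp: padic_Cauchy_ring_def)
    next
      case 3 thus ?case by (simp add: padic_Cauchy_ring_def padic_null_def)
    next
      case (4 x)
      hence "x \<in> carrier (padic_Cauchy_ring p)" using padic_null_Cauchy[OF assms] by (auto simp: padic_Cauchy_ring_def)
      from neg[OF this] 4 show ?case unfolding a_inv_def[symmetric] by (auto simp: padic_null_def padic_abs_minus[OF assms])
    qed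
  qed (use padic_null_mult[OF assms] in \<open>auto simp: padic_Cauchy_ring_def ring_axioms mult.commute\<close>, use local.ring_axioms in \<open>auto simp: padic_Cauchy_ring_def\<close>)
qed

lemma padic_field_carrierE: assumes "prime p" "x \<in> carrier (padic_field p)"
  obtains s where "padic_Cauchy p s" "x = padic_null p +>\<^bsub>padic_Cauchy_ring p\<^esub> s"
  using assms unfolding padic_field_def FactRing_def A_RCOSETS_def' by (auto simp: padic_Cauchy_ring_def)

lemma padic_coset_eq_iff: assumes "prime p" "padic_Cauchy p s" "padic_Cauchy p t"
  shows "padic_null p +>\<^bsub>padic_Cauchy_ring p\<^esub> s = padic_null p +>\<^bsub>padic_Cauchy_ring p\<^esub> t \<longleftrightarrow> (\<lambda>n. s n - t n) \<in> padic_null p"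
proof -
  interpret ideal "padic_null p" "padic_Cauchy_ring p" by (rule padic_null_ideal[OF assms(1)])
  have c: "s \<in> carrier (padic_Cauchy_ring p)" "t \<in> carrier (padic_Cauchy_ring p)" using assms by (auto simp: padic_Cauchy_ring_def)
  have "\<ominus>\<^bsub>padic_Cauchy_ring p\<^esub> t = (\<lambda>n. - t n)"
    using c by (intro minus_equality) (auto simp: padic_Cauchy_ring_def padic_Cauchy_minus[OF assms(1)])
  thus ?thesis using quotient_eq_iff_same_a_r_cos[OF ideal_axioms c] by (auto simp: a_minus_def padic_Cauchy_ring_def)
qed

lemma padic_field_field: assumes "prime p" shows "field (padic_field p)"
proof -
  interpret ideal "padic_null p" "padic_Cauchy_ring p" by (rule padic_null_ideal[OF assms(1)])
  let ?c = "\<lambda>s. padic_null p +>\<^bsub>padic_Cauchy_ring p\<^esub> s"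
  interpret Q: cring "padic_field p" unfolding padic_field_def
    by (rule quotient_is_cring) (rule padic_Cauchy_cring[OF assms])
  have one: "\<one>\<^bsub>padic_field p\<^esub> = ?c (\<lambda>_. 1)" by (simp add: padic_field_def FactRing_def padic_Cauchy_ring_def)
  have zero: "\<zero>\<^bsub>padic_field p\<^esub> = ?c (\<lambda>_. 0)" using a_rcos_const[of "\<lambda>_. 0"] zero_closed 
    by (simp add: padic_field_def FactRing_def padic_Cauchy_ring_def padic_null_def)
  have mult: "?c s \<otimes>\<^bsub>padic_field p\<^esub> ?c t = ?c (\<lambda>n. s n * t n)" if "padic_Cauchy p s" "padic_Cauchy p t" for s t
    using rcoset_mult_add[of s t] that by (simp add: padic_field_def FactRing_def padic_Cauchy_ring_def)
  show ?thesis
  proof (rule Q.cring_fieldI2)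
    show "\<zero>\<^bsub>padic_field p\<^esub> \<noteq> \<one>\<^bsub>padic_field p\<^esub>" unfolding one zero padic_coset_eq_iff[OF assms padic_Cauchy_const padic_Cauchy_const]
      by (auto simp: padic_null_def padic_abs_minus[OF assms] LIMSEQ_const_iff)
    fix x assume x: "x \<in> carrier (padic_field p)" "x \<noteq> \<zero>\<^bsub>padic_field p\<^esub>"
    obtain s where s: "padic_Cauchy p s" "x = ?c s" using padic_field_carrierE[OF assms x(1)] .
    have "s \<notin> padic_null p" using x(2) unfolding s zero padic_coset_eq_iff[OF assms s(1) padic_Cauchy_const] by simp
    moreover obtain L where L: "(\<lambda>n. padic_abs p (s n)) \<longlonglongrightarrow> L"
      using padic_Cauchy_abs[OF assms s(1)] Cauchy_convergent_iff convergent_def by blast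
    ultimately have "L \<noteq> 0" by (auto simp: padic_null_def)
    moreover have "L \<ge> 0" using L padic_abs_nonneg by (meson LIMSEQ_le_const)
    ultimately have L0: "L/2 > 0" "L/2 < L" by auto
    obtain N where N: "\<And>n. n \<ge> N \<Longrightarrow> padic_abs p (s n) > L/2"
      using order_tendstoD(1)[OF L L0(2)] unfolding eventually_sequentially by auto
    define t where "t = (\<lambda>n. 1 / s n)"
    have t: "padic_Cauchy p t" unfolding padic_Cauchy_def
    proof (intro allI impI)
      fix e::real assume e: "e > 0"
      have "e * ((L/2)*(L/2)) > 0" using e L0 by (intro mult_pos_pos)
      then obtain M where M: "\<forall>i\<ge>M. \<forall>j\<ge>M. padic_abs p (s i - s j) < e * ((L/2)*(L/2))"
        using s(1) unfolding padic_Cauchy_def by blast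
      have "padic_abs p (t i - t j) < e" if "i \<ge> max M N" "j \<ge> max M N" for i j
      proof -
        have a: "padic_abs p (s i) > L/2" "padic_abs p (s j) > L/2" using N that by auto
        hence nz: "s i \<noteq> 0" "s j \<noteq> 0" using L0 by auto
        have "(t i - t j) * (s i * s j) = s j - s i" using nz by (simp add: t_def field_simps)
        hence "padic_abs p (t i - t j) * (padic_abs p (s i) * padic_abs p (s j)) = padic_abs p (s j - s i)"
          by (metis padic_abs_mult[OF assms])
        also have "\<dots> < e * ((L/2)*(L/2))" using M that by auto
        also have "\<dots> \<le> e * (padic_abs p (s i) * padic_abs p (s j))" using a e L0 by (intro mult_left_mono mult_mono) auto
        finally show ?thesis using a L0 by (metis mult_less_cancel_right_pos mult_pos_pos less_trans)
      qed
      thus "\<exists>N. \<forall>i\<ge>N. \<forall>j\<ge>N. padic_abs p (t i - t j) < e" by blast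
    qed
    have "(\<lambda>n. padic_abs p (s n * t n - 1)) \<longlonglongrightarrow> 0"
    proof (rule tendsto_eventually)
      have "s n * t n - 1 = 0" if "n \<ge> N" for n using N[OF that] L0 by (auto simp: t_def)
      thus "\<forall>\<^sub>F n in sequentially. padic_abs p (s n * t n - 1) = 0" 
        unfolding eventually_sequentially by (metis padic_abs_0)
    qed
    hence "x \<otimes>\<^bsub>padic_field p\<^esub> ?c t = \<one>\<^bsub>padic_field p\<^esub>"
      unfolding s(2) mult[OF s(1) t] one padic_coset_eq_iff[OF assms padic_Cauchy_mult[OF assms s(1) t] padic_Cauchy_const]
      by (simp add: padic_null_def)
    moreover have "?c t \<in> carrier (padic_field p)" using t
      unfolding padic_field_def FactRing_def A_RCOSETS_def' by (auto simp: padic_Cauchy_ring_def)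
    ultimately show "\<exists>b\<in>carrier (padic_field p). x \<otimes>\<^bsub>padic_field p\<^esub> b = \<one>\<^bsub>padic_field p\<^esub>" by blast
  qed
qed

lemma rat_in_padic:
  assumes "prime p"
  shows "rat_in (padic_field p) q = padic_null p +>\<^bsub>padic_Cauchy_ring p\<^esub> (\<lambda>_. q)"
proof -
  interpret ideal "padic_null p" "padic_Cauchy_ring p" by (rule padic_null_ideal[OF assms(1)])
  interpret Q: field "padic_field p" by (rule padic_field_field[OF assms])
  let ?c = "\<lambda>s. padic_null p +>\<^bsub>padic_Cauchy_ring p\<^esub> s"
  have car: "?c (\<lambda>_. r) \<in> carrier (padic_field p)" for r
  proof -
    have "(\<lambda>_. r) \<in> carrier (padic_Cauchy_ring p)" by (simp add: padic_Cauchy_ring_def)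
    thus ?thesis unfolding padic_field_def FactRing_def A_RCOSETS_def' by auto
  qed
  have one: "\<one>\<^bsub>padic_field p\<^esub> = ?c (\<lambda>_. 1)" by (simp add: padic_field_def FactRing_def padic_Cauchy_ring_def)
  have mult: "?c (\<lambda>_. r) \<otimes>\<^bsub>padic_field p\<^esub> ?c (\<lambda>_. r') = ?c (\<lambda>_. r * r')" for r r'
    using rcoset_mult_add[of "\<lambda>_. r" "\<lambda>_. r'"] by (simp add: padic_field_def FactRing_def padic_Cauchy_ring_def)
  have add: "?c (\<lambda>_. r) \<oplus>\<^bsub>padic_field p\<^esub> ?c (\<lambda>_. r') = ?c (\<lambda>_. r + r')" for r r'
    using a_rcos_sum[of "\<lambda>_. r" "\<lambda>_. r'"] by (simp add: padic_field_def FactRing_def padic_Cauchy_ring_def)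
  have zero: "\<zero>\<^bsub>padic_field p\<^esub> = ?c (\<lambda>_. 0)" using a_rcos_const[of "\<lambda>_. 0"] zero_closed
    by (simp add: padic_field_def FactRing_def padic_Cauchy_ring_def padic_null_def)
  have step: "[(k + 1)] \<cdot>\<^bsub>padic_field p\<^esub> ?c (\<lambda>_. 1) = [k] \<cdot>\<^bsub>padic_field p\<^esub> ?c (\<lambda>_. 1) \<oplus>\<^bsub>padic_field p\<^esub> ?c (\<lambda>_. 1)" for k :: int
    using Q.add.int_pow_mult[OF car, of k 1] Q.add.int_pow_1[OF car] by metis
  have pw: "[k] \<cdot>\<^bsub>padic_field p\<^esub> ?c (\<lambda>_. 1) = ?c (\<lambda>_. of_int k)" for k :: int
  proof (induction k rule: int_induct[where k=0])
    case base show ?case using zero by (simp add: add_pow_def)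
  next
    case (step1 i) thus ?case unfolding step step1 add by simp
  next
    case (step2 i)
    have "[(i - 1)] \<cdot>\<^bsub>padic_field p\<^esub> ?c (\<lambda>_. 1) \<oplus>\<^bsub>padic_field p\<^esub> ?c (\<lambda>_. 1) = [i] \<cdot>\<^bsub>padic_field p\<^esub> ?c (\<lambda>_. 1)"
      using step[of "i - 1"] by simp
    also have "\<dots> = ?c (\<lambda>_. of_int (i-1)) \<oplus>\<^bsub>padic_field p\<^esub> ?c (\<lambda>_. 1)" unfolding step2 add by simp
    finally show ?case using Q.add.r_cancel[OF _ Q.add.int_pow_closed[OF car] car car] by blast
  qed
  obtain a b where ab: "quotient_of q = (a, b)" by (cases "quotient_of q")
  have b: "b > 0" by (rule quotient_of_denom_pos[OF ab])
  have "inv\<^bsub>padic_field p\<^esub> (?c (\<lambda>_. of_int b)) = ?c (\<lambda>_. 1 / of_int b)"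
    using b by (intro Q.comm_inv_char car) (simp_all add: mult one)
  moreover have "of_int a * (1 / of_int b) = q" unfolding quotient_of_div[OF ab] by simp
  ultimately show ?thesis by (simp add: rat_in_def ab one pw mult)
qed

end

theory Submission
  imports Defs
begin

text \<open>Write \<open>n = m - 2\<close>, \<open>P(x) = n x (x - 1) / 2 + x\<close> and \<open>a \<le> b \<le> c\<close>. If \<open>q\<close> divides \<open>n\<close>, then
  \<open>P\<close> is onto the \<open>p\<close>-adic integers for every prime \<open>p\<close> dividing \<open>q\<close> (up to a caveat at \<open>2\<close>), so a
  nonnegative integer of the form \<open>a P(k/q) + b P(l/q)\<close> is locally represented. Integrality is a
  conic condition on \<open>(k, l)\<close> modulo \<open>q\<close>, and a large \<open>n\<close> has a divisor \<open>q\<close>, a large prime or a large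
  prime power whose square divides \<open>n\<close>, such that the conic has many points modulo \<open>q\<close>. The condition
  also survives integral shifts of \<open>k/q\<close> and \<open>l/q\<close>. Regularity makes each of these numbers equal to
  \<open>a P(x) + b P(y) + c P(z)\<close> with integers \<open>x\<close>, \<open>y\<close>, \<open>z\<close>.

  If \<open>b / a\<close> is bounded, small shifts are represented by bounded \<open>x\<close>, \<open>y\<close>, \<open>z\<close>, and differences of three
  of these values recover \<open>(k, l)\<close>, which bounds the number of points of the conic. If \<open>b / a\<close> is large,
  fix one point with \<open>P(k/q)\<close> and \<open>P(l/q)\<close> not both zero and consider about \<open>\<rho> = sqrt (b / a)\<close> shifts
  \<open>k/q + i\<close>. Only boundedly many \<open>(y, z)\<close> occur, and for fixed \<open>(y, z)\<close> the pairs \<open>(i, x)\<close> lie on a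
  nondegenerate hyperbola, where a difference vector occurs at most once; hence a box of size \<open>\<rho>\<close>
  contains only \<open>o(\<rho>)\<close> of them, a contradiction.\<close>

section \<open>Values of \<open>m\<close>-gonal forms in concrete fields\<close>

text \<open>A copy on field types: all computations take place with rational or real numbers, and
  the ring records enter only through the transfer lemmas.\<close>

definition gonal :: "int \<Rightarrow> 'a::field_char_0 \<Rightarrow> 'a" where
  "gonal m x = ((of_int m - 2) * x\<^sup>2 - (of_int m - 4) * x) / 2"

lemma finsum_lessThan_3:
  assumes "abelian_monoid K" "f \<in> {..<3::nat} \<rightarrow> carrier K"
  shows "(\<Oplus>\<^bsub>K\<^esub>i\<in>{..<3::nat}. f i) = f 0 \<oplus>\<^bsub>K\<^esub> (f 1 \<oplus>\<^bsub>K\<^esub> f 2)"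
proof -
  interpret abelian_monoid K by fact
  have "{..<3::nat} = insert 0 (insert 1 {2})" by auto
  moreover have "f 0 \<in> carrier K" "f 1 \<in> carrier K" "f 2 \<in> carrier K"
    using assms(2) by auto
  ultimately show ?thesis by simp
qed

lemma rat_in_type_algebra:
  "rat_in (ring_of_type_algebra :: 'a::field_char_0 ring) q = of_rat q"
proof -
  let ?K = "ring_of_type_algebra :: 'a ring"
  interpret field ?K by rule
  have car: "carrier ?K = UNIV" by (simp add: ring_of_type_algebra_def)
  have step: "[(k + 1)] \<cdot>\<^bsub>?K\<^esub> \<one>\<^bsub>?K\<^esub> = [k] \<cdot>\<^bsub>?K\<^esub> \<one>\<^bsub>?K\<^esub> + (1::'a)" for k :: int
    using add.int_pow_mult[OF one_closed, of k 1] add.int_pow_1[OF one_closed]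
    by (metis ring_of_type_algebra_def ring.simps(2) monoid.simps(2))
  have "[k] \<cdot>\<^bsub>?K\<^esub> \<one>\<^bsub>?K\<^esub> = of_int k" for k :: int
  proof (induction k rule: int_induct[where k=0])
    case base show ?case by (simp add: add_pow_def) (simp add: ring_of_type_algebra_def)
  next
    case (step1 i) thus ?case by (simp add: step)
  next
    case (step2 i) thus ?case using step[of "i - 1"] by (simp add: algebra_simps)
  qed
  moreover have "inv\<^bsub>?K\<^esub> x = inverse x" if "x \<noteq> 0" for x :: 'a
    using that by (intro comm_inv_char) (auto simp: ring_of_type_algebra_def)
  moreover obtain a b where ab: "quotient_of q = (a, b)" by (cases "quotient_of q")
  moreover have "b > 0" by (rule quotient_of_denom_pos[OF ab])
  moreover have "q = of_int a / of_int b" by (rule quotient_of_div[OF ab])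
  ultimately show ?thesis
    by (simp add: rat_in_def of_rat_divide)
       (simp add: ring_of_type_algebra_def divide_inverse)
qed

lemma gonal_form_type_algebra:
  "gonal_form (ring_of_type_algebra :: 'a::field_char_0 ring) m [a, b, c] x =
     of_nat a * gonal m (x 0) + of_nat b * gonal m (x 1) + of_nat c * gonal m (x 2)"
proof -
  let ?K = "ring_of_type_algebra :: 'a ring"
  interpret field ?K by rule
  have car: "carrier ?K = UNIV" by (simp add: ring_of_type_algebra_def)
  have minus: "y \<ominus>\<^bsub>?K\<^esub> z = y - z" for y z
  proof -
    have "\<ominus>\<^bsub>?K\<^esub> z = - z" by (intro minus_equality) (auto simp: car ring_of_type_algebra_def)
    thus ?thesis by (simp add: a_minus_def) (simp add: ring_of_type_algebra_def)
  qed
  have pow: "y [^]\<^bsub>?K\<^esub> (2::nat) = y\<^sup>2" for y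
    unfolding numeral_2_eq_2 nat_pow_Suc nat_pow_0
    by (simp add: ring_of_type_algebra_def)
  have number: "gonal_number ?K m y = gonal m y" for y
    unfolding gonal_number_def rat_in_type_algebra minus pow gonal_def
    by (simp add: ring_of_type_algebra_def of_rat_divide of_rat_diff diff_divide_distrib)
  show ?thesis
    unfolding gonal_form_def number rat_in_type_algebra length_Cons list.size
    using finsum_lessThan_3[of ?K "\<lambda>i. of_rat (of_nat ([a,b,c] ! i)) \<otimes>\<^bsub>?K\<^esub> gonal m (x i)"]
    by (simp add: abelian_monoid_axioms car numeral_3_eq_3 numeral_2_eq_2)
       (simp add: ring_of_type_algebra_def)
qed


section \<open>Classes of Cauchy sequences in the p-adic field\<close>

definition padic_class :: "nat \<Rightarrow> (nat \<Rightarrow> rat) \<Rightarrow> (nat \<Rightarrow> rat) set" where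
  "padic_class p s = padic_null p +>\<^bsub>padic_Cauchy_ring p\<^esub> s"

context
  fixes p :: nat
  assumes p: "prime p"
begin

lemma padic_class_closed: "padic_Cauchy p s \<Longrightarrow> padic_class p s \<in> carrier (padic_field p)"
  unfolding padic_field_def FactRing_def A_RCOSETS_def' padic_class_def
  by (auto simp: padic_Cauchy_ring_def)

lemma padic_class_add:
  assumes "padic_Cauchy p s" "padic_Cauchy p t"
  shows "padic_class p s \<oplus>\<^bsub>padic_field p\<^esub> padic_class p t = padic_class p (\<lambda>n. s n + t n)"
proof -
  interpret ideal "padic_null p" "padic_Cauchy_ring p" by (rule padic_null_ideal[OF p])
  show ?thesis using a_rcos_sum[of s t] assms
    by (simp add: padic_field_def FactRing_def padic_Cauchy_ring_def padic_class_def)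
qed

lemma padic_class_mult:
  assumes "padic_Cauchy p s" "padic_Cauchy p t"
  shows "padic_class p s \<otimes>\<^bsub>padic_field p\<^esub> padic_class p t = padic_class p (\<lambda>n. s n * t n)"
proof -
  interpret ideal "padic_null p" "padic_Cauchy_ring p" by (rule padic_null_ideal[OF p])
  show ?thesis using rcoset_mult_add[of s t] assms
    by (simp add: padic_field_def FactRing_def padic_Cauchy_ring_def padic_class_def)
qed

lemma padic_class_eq_iff:
  "padic_Cauchy p s \<Longrightarrow> padic_Cauchy p t \<Longrightarrow>
     padic_class p s = padic_class p t \<longleftrightarrow> (\<lambda>n. s n - t n) \<in> padic_null p"
  unfolding padic_class_def by (rule padic_coset_eq_iff[OF p])

lemma rat_in_padic_class: "rat_in (padic_field p) q = padic_class p (\<lambda>_. q)"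
  by (simp add: rat_in_padic[OF p] padic_class_def)

lemma padic_class_minus:
  assumes "padic_Cauchy p s" "padic_Cauchy p t"
  shows "padic_class p s \<ominus>\<^bsub>padic_field p\<^esub> padic_class p t = padic_class p (\<lambda>n. s n - t n)"
proof -
  interpret field "padic_field p" by (rule padic_field_field[OF p])
  have t: "padic_Cauchy p (\<lambda>n. - t n)" by (rule padic_Cauchy_minus[OF p assms(2)])
  have d: "padic_Cauchy p (\<lambda>n. s n - t n)" using padic_Cauchy_add[OF p assms(1) t] by simp
  have "padic_class p s = padic_class p (\<lambda>n. s n - t n) \<oplus>\<^bsub>padic_field p\<^esub> padic_class p t"
    by (simp add: padic_class_add[OF d assms(2)])
  thus ?thesis using padic_class_closed[OF d] padic_class_closed[OF assms(2)]
    by (simp add: a_minus_def a_assoc r_neg)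
qed

lemma gonal_number_padic_class:
  assumes s: "padic_Cauchy p s"
  shows "padic_Cauchy p (\<lambda>n. gonal m (s n))"
    and "gonal_number (padic_field p) m (padic_class p s) = padic_class p (\<lambda>n. gonal m (s n))"
proof -
  interpret field "padic_field p" by (rule padic_field_field[OF p])
  note [simp] = padic_class_mult padic_class_minus padic_class_closed
  have sq: "padic_Cauchy p (\<lambda>n. s n * s n)" by (rule padic_Cauchy_mult[OF p s s])
  have 2: "padic_Cauchy p (\<lambda>n. c * (s n * s n))" and 1: "padic_Cauchy p (\<lambda>n. c * s n)" for c
    using padic_Cauchy_mult[OF p padic_Cauchy_const] s sq by blast+
  have d: "padic_Cauchy p (\<lambda>n. c * (s n * s n) - d * s n)" for c d
    using padic_Cauchy_add[OF p 2[of c] padic_Cauchy_minus[OF p 1[of d]]] by simp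
  have eq: "(\<lambda>n. gonal m (s n)) =
      (\<lambda>n. (1/2) * (of_int (m - 2) * (s n * s n) - of_int (m - 4) * s n))"
    by (simp add: gonal_def power2_eq_square)
  show "padic_Cauchy p (\<lambda>n. gonal m (s n))"
    unfolding eq by (rule padic_Cauchy_mult[OF p padic_Cauchy_const d])
  have "padic_class p s [^]\<^bsub>padic_field p\<^esub> (2::nat) = padic_class p (\<lambda>n. s n * s n)"
    using s by (simp add: numeral_2_eq_2)
  thus "gonal_number (padic_field p) m (padic_class p s) = padic_class p (\<lambda>n. gonal m (s n))"
    unfolding gonal_number_def rat_in_padic_class eq using s sq 1 2 d by simp
qed

text \<open>\<open>padic_integers\<close> bounds the limit for every representative. Another
  representative differs by a null sequence, so by the ultrametric inequality its absolute values
  are eventually at most 1 as well.\<close>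

lemma padic_class_integral:
  assumes s: "padic_Cauchy p s" and le: "\<And>n. padic_abs p (s n) \<le> 1"
  shows "padic_class p s \<in> padic_integers p"
  unfolding padic_integers_def
proof (intro CollectI conjI ballI)
  show "padic_class p s \<in> carrier (padic_field p)" by (rule padic_class_closed[OF s])
  fix t assume "t \<in> padic_class p s"
  then obtain h where h: "h \<in> padic_null p" "t = (\<lambda>n. h n + s n)"
    by (auto simp: padic_class_def a_r_coset_def' padic_Cauchy_ring_def)
  have "padic_Cauchy p t"
    unfolding h(2) by (rule padic_Cauchy_add[OF p padic_null_Cauchy[OF p h(1)] s])
  hence "(\<lambda>n. padic_abs p (t n)) \<longlonglongrightarrow> lim (\<lambda>n. padic_abs p (t n))"
    using padic_Cauchy_abs[OF p] Cauchy_convergent_iff convergent_LIMSEQ_iff by blast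
  moreover obtain N where N: "\<And>n. n \<ge> N \<Longrightarrow> padic_abs p (h n) < 1"
    using h(1) order_tendstoD(2)[of "\<lambda>n. padic_abs p (h n)" 0 sequentially 1]
    unfolding padic_null_def eventually_sequentially by auto
  have "padic_abs p (t n) \<le> 1" if "n \<ge> N" for n
    using padic_abs_ultra[OF p, of "h n" "s n"] le[of n] N[OF that] unfolding h(2) by simp
  ultimately show "lim (\<lambda>n. padic_abs p (t n)) \<le> 1"
    using LIMSEQ_le_const2 by blast
qed

text \<open>Local solvability becomes a matter of exhibiting sequences of p-integral rationals that
  solve the equation up to a null sequence.\<close>

lemma represented_over_padicI:
  fixes s :: "nat \<Rightarrow> nat \<Rightarrow> rat"
  assumes s: "\<And>i. padic_Cauchy p (s i)" and le: "\<And>i n. padic_abs p (s i n) \<le> 1"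
    and null: "(\<lambda>n. of_nat a * gonal m (s 0 n) + of_nat b * gonal m (s 1 n)
                    + of_nat c * gonal m (s 2 n) - l) \<in> padic_null p"
  shows "represented_over (padic_field p) (padic_integers p) m [a, b, c] l"
  unfolding represented_over_def
proof (intro bexI)
  interpret field "padic_field p" by (rule padic_field_field[OF p])
  note [simp] = padic_class_mult padic_class_add padic_class_closed gonal_number_padic_class[OF s]
  have g: "padic_Cauchy p (\<lambda>n. of_nat k * gonal m (s i n))" for k i
    by (intro padic_Cauchy_mult[OF p]) simp_all
  have "gonal_form (padic_field p) m [a, b, c] (\<lambda>i. padic_class p (s i)) =
      padic_class p (\<lambda>n. of_nat a * gonal m (s 0 n) + (of_nat b * gonal m (s 1 n)
                    + of_nat c * gonal m (s 2 n)))"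
    unfolding gonal_form_def
    using finsum_lessThan_3[of "padic_field p" "\<lambda>i. rat_in (padic_field p) (of_nat ([a,b,c] ! i)) \<otimes>\<^bsub>padic_field p\<^esub> gonal_number (padic_field p) m (padic_class p (s i))"]
    by (simp add: abelian_monoid_axioms rat_in_padic_class g padic_Cauchy_add[OF p] numeral_3_eq_3 numeral_2_eq_2)
  also have "\<dots> = rat_in (padic_field p) l"
    unfolding rat_in_padic_class using null
    by (subst padic_class_eq_iff) (simp_all add: g padic_Cauchy_add[OF p] add.assoc)
  finally show "gonal_form (padic_field p) m [a, b, c] (\<lambda>i. padic_class p (s i)) = rat_in (padic_field p) l" .
  show "(\<lambda>i. padic_class p (s i)) \<in> {..<length [a, b, c]} \<rightarrow> padic_integers p"
    using padic_class_integral[OF s le] by blast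
qed

section \<open>Polygonal numbers fill the p-adic integers\<close>

lemma padic_abs_int_div_le_1:
  assumes "\<not> int p dvd b"
  shows "padic_abs p (of_int k / of_int b) \<le> 1"
proof (cases "k = 0")
  case False
  have "b \<noteq> 0" "multiplicity (int p) b = 0"
    using assms by (auto simp: not_dvd_imp_multiplicity_0)
  thus ?thesis
    using padic_abs_frac[OF p False, of b] p prime_gt_1_nat[OF p]
    by (simp add: power_int_minus inverse_le_1_iff)
qed auto

lemma padic_abs_of_int_le_1: "padic_abs p (of_int k) \<le> 1"
  using padic_abs_int_div_le_1[of 1 k] prime_gt_1_nat[OF p] by simp

text \<open>The hypothesis says that p divides n/2 in the p-adic integers; for p = 2 this takes a
  second factor 2 in n.\<close>

lemma padic_abs_half_less_1:
  assumes "2 * int p dvd n \<or> odd p \<and> int p dvd n"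
  shows "padic_abs p (of_int n / 2) < 1"
proof -
  have pp: "padic_abs p (of_nat p) < 1"
    using padic_abs_frac[OF p, of "int p" 1] prime_gt_1_nat[OF p]
    by (simp add: power_int_minus inverse_less_1_iff multiplicity_same_power[of "int p" 1, simplified])
  obtain x where x: "of_int n / 2 = of_nat p * x" "padic_abs p x \<le> 1"
    using assms
  proof
    assume "2 * int p dvd n"
    then obtain k where "n = 2 * int p * k" by blast
    thus ?thesis using that[of "of_int k"] padic_abs_of_int_le_1 by simp
  next
    assume n: "odd p \<and> int p dvd n"
    then obtain k where k: "n = int p * k" by blast
    have "\<not> int p dvd 2"
      using n p prime_gt_1_nat[OF p] by (auto dest!: zdvd_imp_le simp: le_less)
    thus ?thesis using that[of "of_int k / 2"] padic_abs_int_div_le_1[of 2 k] k by simp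
  qed
  have "padic_abs p (of_int n / 2) \<le> padic_abs p (of_nat p) * 1"
    unfolding x(1) padic_abs_mult[OF p]
    using x(2) by (intro mult_left_mono padic_abs_nonneg)
  thus ?thesis using pp by simp
qed

text \<open>Since \<open>n / 2\<close> is divisible by \<open>p\<close>, the map \<open>x \<mapsto> k / a - n / 2 * x * (x - 1)\<close>, whose
  fixed points solve \<open>a * gonal (n + 2) x = k\<close>, is a contraction of the \<open>p\<close>-adic integers.\<close>

lemma padic_gonal_surj:
  assumes n: "2 * int p dvd n \<or> odd p \<and> int p dvd n" and a: "\<not> p dvd a"
  obtains s where "padic_Cauchy p s" "\<And>t. padic_abs p (s t) \<le> 1"
    "(\<lambda>t. of_nat a * gonal (n + 2) (s t) - of_int k) \<in> padic_null p"
proof -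
  define h :: rat where "h = of_int n / 2"
  define \<delta> where "\<delta> = padic_abs p h"
  have \<delta>: "0 \<le> \<delta>" "\<delta> < 1"
    using padic_abs_half_less_1[OF n] by (auto simp: \<delta>_def h_def padic_abs_nonneg)
  define s where "s = rec_nat (0::rat) (\<lambda>_ x. of_int k / of_nat a - h * (x * (x - 1)))"
  have s0: "s 0 = 0" and sS: "s (Suc t) = of_int k / of_nat a - h * (s t * (s t - 1))" for t
    by (simp_all add: s_def)
  have minus: "padic_abs p (x - y) \<le> max (padic_abs p x) (padic_abs p y)" for x y
    using padic_abs_ultra[OF p, of x "-y"] padic_abs_minus[OF p, of y] by simp
  have ka: "padic_abs p (of_int k / of_nat a) \<le> 1"
    using padic_abs_int_div_le_1[of "int a" k] a by simp
  have le: "padic_abs p (s t) \<le> 1" for t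
  proof (induction t)
    case (Suc t)
    have "padic_abs p (s t - 1) \<le> 1" using minus[of "s t" 1] Suc by simp
    hence "padic_abs p (h * (s t * (s t - 1))) \<le> 1"
      unfolding padic_abs_mult[OF p] \<delta>_def[symmetric] using \<delta> Suc
      by (intro mult_le_one mult_nonneg_nonneg padic_abs_nonneg) auto
    thus ?case unfolding sS using minus ka by (meson max.bounded_iff order_trans)
  qed (simp add: s0)
  \<comment> \<open>The iteration maps a difference x - y to -h (x - y) (x + y - 1), whose last
    factor is p-integral, so distances shrink by \<delta>.\<close>
  have step: "padic_abs p (s (Suc t) - s t) \<le> \<delta> ^ t" for t
  proof (induction t)
    case 0 show ?case using le[of "Suc 0"] by (simp add: s0)
  next
    case (Suc t)
    have "padic_abs p (s (Suc t) + s t) \<le> 1"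
      using padic_abs_ultra[OF p, of "s (Suc t)" "s t"] le[of t] le[of "Suc t"] by simp
    hence "padic_abs p (s (Suc t) + s t - 1) \<le> 1" using minus[of "s (Suc t) + s t" 1] by simp
    moreover have "s (Suc (Suc t)) - s (Suc t) = h * (s t * (s t - 1)) - h * (s (Suc t) * (s (Suc t) - 1))"
      using sS[of "Suc t"] sS[of t] by linarith
    hence "s (Suc (Suc t)) - s (Suc t) = - (h * ((s (Suc t) - s t) * (s (Suc t) + s t - 1)))"
      by (simp add: algebra_simps)
    ultimately have "padic_abs p (s (Suc (Suc t)) - s (Suc t)) \<le> \<delta> * (\<delta> ^ t * 1)"
      unfolding \<delta>_def using Suc[unfolded \<delta>_def]
      by (simp only: padic_abs_minus[OF p] padic_abs_mult[OF p])
         (intro mult_left_mono mult_mono padic_abs_nonneg zero_le_power)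
    thus ?case by simp
  qed
  have tail: "padic_abs p (s (i + j) - s i) \<le> \<delta> ^ i" for i j
  proof (induction j)
    case 0 show ?case using \<delta> by simp
  next
    case (Suc j)
    have "\<delta> ^ (i + j) \<le> \<delta> ^ i" using \<delta> by (intro power_decreasing) auto
    thus ?case using padic_abs_ultra[OF p, of "s (Suc (i + j)) - s (i + j)" "s (i + j) - s i"]
        step[of "i + j"] Suc by simp
  qed
  have "(\<lambda>i. \<delta> ^ i) \<longlonglongrightarrow> 0" using \<delta> by (intro LIMSEQ_power_zero) auto
  hence "padic_Cauchy p s"
    unfolding padic_Cauchy_def
  proof (intro allI impI)
    fix e :: real assume "e > 0"
    then obtain N where N: "\<And>i. i \<ge> N \<Longrightarrow> \<delta> ^ i < e"
      using order_tendstoD(2)[OF \<open>(\<lambda>i. \<delta> ^ i) \<longlonglongrightarrow> 0\<close>] unfolding eventually_sequentially by blast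
    have "padic_abs p (s i - s j) < e" if "i \<ge> N" "j \<ge> N" for i j
      using that
    proof (induction i j rule: linorder_wlog)
      case (le i j)
      thus ?case using tail[of i "j - i"] N[of i] padic_abs_minus[OF p, of "s i - s j"] by simp
    next
      case (sym i j) thus ?case using padic_abs_minus[OF p, of "s i - s j"] by simp
    qed
    thus "\<exists>N. \<forall>i\<ge>N. \<forall>j\<ge>N. padic_abs p (s i - s j) < e" by blast
  qed
  moreover have "(\<lambda>t. of_nat a * gonal (n + 2) (s t) - of_int k) \<in> padic_null p"
  proof (rule padic_null_boundedI)
    show "(\<lambda>i. \<delta> ^ i) \<longlonglongrightarrow> 0" by fact
    fix t
    have "of_nat a \<noteq> (0::rat)" using a by (metis dvd_0_right of_nat_eq_0_iff)
    hence "of_nat a * s (Suc t) = of_int k - of_nat a * (h * (s t * (s t - 1)))"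
      by (simp add: sS right_diff_distrib)
    moreover have "gonal (n + 2) (s t) = h * (s t * (s t - 1)) + s t"
      by (simp add: gonal_def h_def power2_eq_square add_divide_distrib diff_divide_distrib algebra_simps)
    hence "of_nat a * gonal (n + 2) (s t) = of_nat a * (h * (s t * (s t - 1))) + of_nat a * s t"
      by (simp add: distrib_left)
    \<comment> \<open>The error of an iterate in the equation is -a times the next increment, which
      \<open>step\<close> bounds.\<close>
    ultimately have eq: "of_nat a * gonal (n + 2) (s t) - of_int k = - (of_nat a * (s (Suc t) - s t))"
      unfolding right_diff_distrib by linarith
    have "padic_abs p (of_nat a * gonal (n + 2) (s t) - of_int k) \<le> 1 * padic_abs p (s (Suc t) - s t)"
      unfolding eq padic_abs_minus[OF p] padic_abs_mult[OF p]
      using padic_abs_of_int_le_1[of "int a"] by (intro mult_right_mono padic_abs_nonneg) simp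
    thus "padic_abs p (of_nat a * gonal (n + 2) (s t) - of_int k) \<le> \<delta> ^ t"
      using step[of t] by simp
  qed
  ultimately show ?thesis using le by (intro that[of s])
qed

end

section \<open>Locally represented numbers\<close>

text \<open>\<open>2 * q\<close> times the value of the polygonal number with \<open>m = n + 2\<close> at \<open>k / q\<close>, where \<open>n = q * r\<close>.\<close>

definition twist :: "int \<Rightarrow> int \<Rightarrow> int \<Rightarrow> int" where
  "twist n r k = k * (r * k - n + 2)"

lemma gonal_frac:
  assumes "n = q * r" "q > 0"
  shows "gonal (n + 2) (of_int k / of_int q) = of_int (twist n r k) / (2 * of_int q)"
proof -
  have "of_int q \<noteq> (0::'a)" using assms by simp
  thus ?thesis by (simp add: gonal_def twist_def assms(1) field_simps power2_eq_square)
qed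

lemma gonal_of_int: "gonal (n + 2) (of_int k) = of_int (twist n n k) / 2"
  using gonal_frac[of n 1 n k] by simp

lemma gonal_0 [simp]: "gonal m 0 = 0"
  by (simp add: gonal_def)

lemma gonal_surj_real:
  assumes "n > 0" "d \<ge> 0"
  obtains x :: real where "gonal (n + 2) x = d"
proof -
  \<comment> \<open>The root of the discriminant of n x^2 - (n - 2) x - 2 d.\<close>
  define D where "D = sqrt ((of_int n - 2)\<^sup>2 + 8 * of_int n * d)"
  have D: "D\<^sup>2 = (of_int n - 2)\<^sup>2 + 8 * of_int n * d"
    unfolding D_def using assms by (intro real_sqrt_pow2) simp
  have "gonal (n + 2) ((of_int n - 2 + D) / (2 * of_int n)) = (D\<^sup>2 - (of_int n - 2)\<^sup>2) / (8 * of_int n)"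
    using assms(1) by (simp add: gonal_def field_simps power2_eq_square)
  also have "\<dots> = d" unfolding D using assms(1) by simp
  finally show ?thesis using that by blast
qed

text \<open>Denominators \<open>q\<close> such that the \<open>(n + 2)\<close>-gonal numbers fill the \<open>p\<close>-adic integers for every
  prime \<open>p\<close> that divides \<open>q\<close>; arguments \<open>k / q\<close> are then harmless at every prime.\<close>

definition admissible :: "int \<Rightarrow> int \<Rightarrow> int \<Rightarrow> bool" where
  "admissible n q r \<longleftrightarrow> n = q * r \<and> q > 0 \<and>
     (\<forall>p::nat. prime p \<longrightarrow> int p dvd q \<longrightarrow> 2 * int p dvd n \<or> odd p \<and> int p dvd n)"

lemma admissibleD:
  assumes "admissible n q r"
  shows "n = q * r" "q > 0" "prime p \<Longrightarrow> int p dvd q \<Longrightarrow> 2 * int p dvd n \<or> odd p \<and> int p dvd n"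
  using assms unfolding admissible_def by blast+

text \<open>At a prime not dividing q the point (k1/q, k2/q, k3/q) is itself a p-integral solution.
  At a prime dividing q some coefficient is a unit by primitivity, and its variable alone reaches N.
  Over the reals the first variable suffices because N is nonnegative.\<close>

lemma locally_represented_twist:
  assumes prim: "primitive_form [a, b, c]" and a: "a > 0" and n: "n > 0" and adm: "admissible n q r"
    and N: "N \<ge> 0" "2 * q * N = int a * twist n r k1 + int b * twist n r k2 + int c * twist n r k3"
  shows "locally_represented (n + 2) [a, b, c] (of_int N)"
  unfolding locally_represented_def
proof (intro conjI allI impI)
  obtain x where x: "gonal (n + 2) x = of_int N / real a"
    using gonal_surj_real[of n "of_int N / real a"] n N by auto
  show "represented_over (ring_of_type_algebra :: real ring) UNIV (n + 2) [a, b, c] (of_int N)"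
    unfolding represented_over_def rat_in_type_algebra gonal_form_type_algebra
    by (rule bexI[of _ "\<lambda>i. if i = 0 then x else 0"]) (use x a in auto)
next
  fix p :: nat assume p: "prime p"
  show "represented_over (padic_field p) (padic_integers p) (n + 2) [a, b, c] (of_int N)"
  proof (cases "int p dvd q")
    case False
    \<comment> \<open>\<open>min i 2\<close> extends the three arguments to all indices, since
      \<open>represented_over_padicI\<close> asks for a sequence at every index.\<close>
    define x :: "nat \<Rightarrow> rat" where "x i = of_int ([k1, k2, k3] ! min i 2) / of_int q" for i
    have "2 * of_int q * (of_int N :: rat) = of_nat a * of_int (twist n r k1)
        + of_nat b * of_int (twist n r k2) + of_nat c * of_int (twist n r k3)"
      using arg_cong[OF N(2), of "of_int :: int \<Rightarrow> rat"] by simp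
    hence "of_nat a * gonal (n + 2) (x 0) + of_nat b * gonal (n + 2) (x 1) + of_nat c * gonal (n + 2) (x 2) - of_int N = 0"
      using admissibleD(2)[OF adm] by (simp add: x_def gonal_frac[OF admissibleD(1,2)[OF adm]] field_simps min_def numeral_2_eq_2)
    thus ?thesis
      using padic_abs_int_div_le_1[OF p False]
      by (intro represented_over_padicI[OF p, of "\<lambda>i _. x i"]) (simp_all add: x_def padic_null_def)
  next
    case True
    have "\<not> (p dvd a \<and> p dvd b \<and> p dvd c)"
    proof
      assume "p dvd a \<and> p dvd b \<and> p dvd c"
      hence "p dvd Gcd (set [a, b, c])" by (intro Gcd_greatest) auto
      hence "p dvd 1" using prim by (simp only: primitive_form_def)
      thus False using p by simp
    qed
    then obtain i where i: "i < 3" "\<not> p dvd [a, b, c] ! i"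
      by (metis lessI less_SucI nth_Cons_0 nth_Cons_Suc numeral_3_eq_3 zero_less_Suc)
    obtain s where s: "padic_Cauchy p s" "\<And>t. padic_abs p (s t) \<le> 1"
      "(\<lambda>t. of_nat ([a, b, c] ! i) * gonal (n + 2) (s t) - of_int N) \<in> padic_null p"
      using padic_gonal_surj[OF p admissibleD(3)[OF adm p True] i(2)] by blast
    have "i = 0 \<or> i = 1 \<or> i = 2" using i(1) by auto
    hence "(\<lambda>t. of_nat a * gonal (n + 2) (if 0 = i then s t else 0) + of_nat b * gonal (n + 2) (if 1 = i then s t else 0)
        + of_nat c * gonal (n + 2) (if 2 = i then s t else 0) - of_int N) \<in> padic_null p"
      using s(3) by auto
    moreover have "padic_Cauchy p (\<lambda>t. if j = i then s t else 0)" for j :: nat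
      using s(1) by (cases "j = i") simp_all
    ultimately show ?thesis
      using s(2) by (intro represented_over_padicI[OF p, of "\<lambda>j t. if j = i then s t else 0"]) simp_all
  qed
qed

text \<open>The consequence of regularity on which the rest of the proof rests, stated over the
  integers: the factors 2 q and 2 clear the denominators. The coefficients may be permuted, which
  later allows sorting them.\<close>

definition represents_twists :: "int \<Rightarrow> int \<Rightarrow> int \<Rightarrow> int \<Rightarrow> bool" where
  "represents_twists n a b c \<longleftrightarrow> (\<forall>q r k1 k2 k3 N.
     admissible n q r \<longrightarrow> N \<ge> 0 \<longrightarrow> 2 * q * N = a * twist n r k1 + b * twist n r k2 + c * twist n r k3 \<longrightarrow>
     (\<exists>x y z. 2 * N = a * twist n n x + b * twist n n y + c * twist n n z))"

lemma regular_imp_represents_twists: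
  assumes "regular_form (n + 2) [a, b, c]" "primitive_form [a, b, c]" "a > 0" "n > 0"
  shows "represents_twists n (int a) (int b) (int c)"
  unfolding represents_twists_def
proof (intro allI impI)
  fix q r k1 k2 k3 N
  assume "admissible n q r" "N \<ge> 0" "2 * q * N = int a * twist n r k1 + int b * twist n r k2 + int c * twist n r k3"
  hence "locally_represented (n + 2) [a, b, c] (of_int N)"
    by (intro locally_represented_twist[OF assms(2-4)])
  hence "globally_represented (n + 2) [a, b, c] (of_int N)"
    using assms(1) by (simp add: regular_form_def)
  then obtain w :: "nat \<Rightarrow> rat" where w: "w \<in> {..<3} \<rightarrow> \<int>"
    "of_nat a * gonal (n + 2) (w 0) + of_nat b * gonal (n + 2) (w 1) + of_nat c * gonal (n + 2) (w 2) = of_int N"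
    unfolding globally_represented_def represented_over_def rat_in_type_algebra gonal_form_type_algebra
    by (auto simp: numeral_3_eq_3)
  have "w 0 \<in> \<int>" "w 1 \<in> \<int>" "w 2 \<in> \<int>" using w(1) by auto
  then obtain x y z where "w 0 = of_int x" "w 1 = of_int y" "w 2 = of_int z"
    by (auto elim!: Ints_cases)
  hence "of_int (2 * N) = (of_int (int a * twist n n x + int b * twist n n y + int c * twist n n z) :: rat)"
    using w(2) by (simp add: gonal_of_int)
  thus "\<exists>x y z. 2 * N = int a * twist n n x + int b * twist n n y + int c * twist n n z"
    unfolding of_int_eq_iff by blast
qed

section \<open>Bounded ratio of the two smallest coefficients\<close>

lemma twist_shift: "n = q * r \<Longrightarrow> twist n r (k + q * i) = twist n r k + q * (2 * r * k * i + twist n n i)"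
  by (simp add: twist_def algebra_simps)

text \<open>Shifting k/q by i changes the polygonal number by r k i plus the polygonal number of i,
  which is an integer because q divides n.\<close>

lemma twist_shift_dvd:
  assumes n: "n = q * r" and dvd: "2 * q dvd a * twist n r k + b * twist n r l"
  shows "2 * q dvd a * twist n r (k + q * i) + b * twist n r (l + q * j)"
proof -
  have "2 dvd twist n n t" for t by (auto simp: twist_def)
  hence "2 * q dvd q * (2 * r * k * i + twist n n i)" "2 * q dvd q * (2 * r * l * j + twist n n j)"
    by (auto simp: mult.commute[of 2 q])
  from dvd_add[OF dvd dvd_add[OF dvd_mult[OF this(1), of a] dvd_mult[OF this(2), of b]]]
  show ?thesis unfolding twist_shift[OF n] by (simp add: algebra_simps)
qed

text \<open>The gap below 2 is what forces y- and z-terms to vanish when their total is less than b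
  in \<open>ratio_le\<close>.\<close>

lemma twist_eq_0_or_ge_2:
  assumes "n \<ge> 2"
  shows "twist n n x = 0 \<or> twist n n x \<ge> 2"
proof -
  consider "x \<ge> 1" | "x = 0" | "x \<le> -1" by linarith
  thus ?thesis
  proof cases
    case 1
    hence "n * x \<ge> n * 1" using assms by (intro mult_left_mono) auto
    hence "x * (n * x - n + 2) \<ge> 1 * 2" using 1 by (intro mult_mono) auto
    thus ?thesis by (simp add: twist_def)
  next
    case 3
    hence "n * (-x) \<ge> n * 1" using assms by (intro mult_left_mono) auto
    hence "(-x) * (n * (-x) + n - 2) \<ge> 1 * 2" using 3 assms by (intro mult_mono) auto
    thus ?thesis by (simp add: twist_def algebra_simps)
  qed (simp add: twist_def)
qed

lemma twist_nonneg: "n \<ge> 2 \<Longrightarrow> twist n n x \<ge> 0"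
  using twist_eq_0_or_ge_2[of n x] by linarith

text \<open>For \<open>\<bar>x\<bar> \<ge> 2\<close> the linear term takes away at most half of n
  x^2. The bound is independent of n, which is why the final constant is absolute.\<close>

lemma square_le_of_twist_le:
  assumes n: "n \<ge> 2" and x: "twist n n x \<le> n * B" and B: "B \<ge> 1"
  shows "x\<^sup>2 \<le> 2 * B"
proof (cases "\<bar>x\<bar> \<ge> 2")
  case True
  have "\<bar>x\<bar> * 2 \<le> \<bar>x\<bar> * \<bar>x\<bar>" using True by (intro mult_left_mono) auto
  hence "2 * \<bar>x\<bar> \<le> x\<^sup>2" by (simp add: power2_eq_square)
  have "(n - 2) * x \<le> (n - 2) * \<bar>x\<bar>" using n by (intro mult_left_mono) auto
  also have "\<dots> \<le> n * \<bar>x\<bar>" by (intro mult_right_mono) auto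
  finally have "(n - 2) * x \<le> n * \<bar>x\<bar>" .
  hence "n * x\<^sup>2 - n * \<bar>x\<bar> \<le> n * B"
    using x by (simp add: twist_def power2_eq_square algebra_simps)
  moreover have "n * (2 * \<bar>x\<bar>) \<le> n * x\<^sup>2" using n \<open>2 * \<bar>x\<bar> \<le> x\<^sup>2\<close> by (intro mult_left_mono) auto
  ultimately have "n * x\<^sup>2 \<le> n * (2 * B)" by linarith
  thus ?thesis using n by simp
next
  case False
  hence "x = -1 \<or> x = 0 \<or> x = 1" by linarith
  thus ?thesis using B by auto
qed

lemma abs_le_of_twist_le:
  assumes "n \<ge> 2" "twist n n x \<le> n * B" "B \<ge> 1" "2 * B \<le> K\<^sup>2" "K \<ge> 0"
  shows "\<bar>x\<bar> \<le> K"
  using square_le_of_twist_le[OF assms(1-3)] assms(4,5)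
  by (metis abs_le_square_iff abs_of_nonneg order_trans)

text \<open>The third argument is put equal to 0, so the represented value does not involve
  c.\<close>

lemma represents_twists_two:
  assumes rep: "represents_twists n a b c" and adm: "admissible n q r"
    and dvd: "2 * q dvd a * twist n r u + b * twist n r v"
    and ge: "a * twist n r u + b * twist n r v \<ge> 0"
  obtains x y z where
    "a * twist n r u + b * twist n r v = q * (a * twist n n x + b * twist n n y + c * twist n n z)"
proof -
  obtain N where N: "a * twist n r u + b * twist n r v = 2 * q * N" using dvd by blast
  have q: "q > 0" using admissibleD[OF adm] by auto
  hence "N \<ge> 0" using ge unfolding N by (simp add: zero_le_mult_iff)
  moreover have "2 * q * N = a * twist n r u + b * twist n r v + c * twist n r 0"
    using N by (simp add: twist_def[of _ _ 0])
  ultimately obtain x y z where "2 * N = a * twist n n x + b * twist n n y + c * twist n n z"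
    using rep adm unfolding represents_twists_def by blast
  hence "q * (2 * N) = q * (a * twist n n x + b * twist n n y + c * twist n n z)" by simp
  thus ?thesis using that N by (simp add: algebra_simps)
qed

text \<open>The values at the shifts \<open>(1, 1)\<close>, \<open>(2, 1)\<close> and \<open>(1, 2)\<close> determine \<open>(k, l)\<close>, and each of them
  is given by a triple of integers of absolute value at most \<open>60 T\<close>.\<close>

lemma card_integral_pairs_le:
  assumes rep: "represents_twists n a b c" and adm: "admissible n q r" and n: "n \<ge> 3"
    and abc: "0 < a" "a \<le> b" "b \<le> c" and T: "b \<le> T * a"
    and S: "S \<subseteq> {0..<q} \<times> {0..<q}"
    and dvd: "\<And>k l. (k, l) \<in> S \<Longrightarrow> 2 * q dvd a * twist n r k + b * twist n r l"
  shows "int (card S) \<le> (120 * T + 1) ^ 9"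
proof -
  have nq: "n = q * r" and q: "q > 0" using admissibleD[OF adm] by auto
  have r: "r > 0" using n q nq zero_less_mult_pos[of q r] by linarith
  have "1 * a \<le> T * a" using T abc by linarith
  hence T1: "T \<ge> 1" using abc by simp
  define R where "R = 60 * T"
  have le_R: "\<bar>x\<bar> \<le> R" if "twist n n x \<le> n * (18 * T)" for x
  proof (rule abs_le_of_twist_le[OF _ that])
    have "T * 1 \<le> T * T" using T1 by (intro mult_left_mono) auto
    thus "2 * (18 * T) \<le> R\<^sup>2" unfolding R_def power2_eq_square using T1 by simp
  qed (use n T1 in \<open>auto simp: R_def\<close>)
  define Box where "Box = {-R..R} \<times> {-R..R} \<times> {-R..R}"
  define val where "val = (\<lambda>(x, y, z). q * (a * twist n n x + b * twist n n y + c * twist n n z))"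
  have ex: "\<exists>w\<in>Box. a * twist n r (k + q * i) + b * twist n r (l + q * j) = val w"
    if kl: "(k, l) \<in> S" and i: "i \<in> {1, 2}" and j: "j \<in> {1, 2}" for k l i j
  proof -
    \<comment> \<open>A shift by at least one period makes the second factor of \<open>twist\<close>
      positive. The factors are at most 3 q and 3 n, hence the 9, and the two summands give 18 b
      because \<open>a \<le> b\<close>.\<close>
    have bounds: "0 \<le> twist n r (u + q * t)" "twist n r (u + q * t) \<le> q * (n * 9)"
      if u: "0 \<le> u" "u < q" and t: "t \<in> {1, 2}" for u t
    proof -
      have qt: "q \<le> q * t" "q * t \<le> 2 * q" using q t by auto
      have "r * (u + q * t) \<le> r * (3 * q)" "r * (u + q * t) \<ge> r * q"
        using u qt r by (intro mult_left_mono; linarith)+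
      moreover have "r * (3 * q) = 3 * n" "r * q = n" by (simp_all add: nq)
      ultimately have f: "0 \<le> r * (u + q * t) - n + 2" "r * (u + q * t) - n + 2 \<le> 3 * n"
        using n by linarith+
      have g: "0 \<le> u + q * t" "u + q * t \<le> 3 * q" using u qt by linarith+
      show "0 \<le> twist n r (u + q * t)" unfolding twist_def using f g by simp
      have "twist n r (u + q * t) \<le> (3 * q) * (3 * n)"
        unfolding twist_def using f g q by (intro mult_mono) auto
      thus "twist n r (u + q * t) \<le> q * (n * 9)" by simp
    qed
    have k: "0 \<le> k" "k < q" and l: "0 \<le> l" "l < q" using S kl by auto
    note bk = bounds[OF k i] and bl = bounds[OF l j]
    have "a * twist n r (k + q * i) + b * twist n r (l + q * j) \<le> a * (q * (n * 9)) + b * (q * (n * 9))"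
      using bk bl abc by (intro add_mono mult_left_mono) auto
    also have "\<dots> \<le> q * (n * (18 * b))" using abc q n by (simp add: algebra_simps)
    finally have le: "a * twist n r (k + q * i) + b * twist n r (l + q * j) \<le> q * (n * (18 * b))" .
    have ge: "0 \<le> a * twist n r (k + q * i) + b * twist n r (l + q * j)"
      using bk bl abc by simp
    have "2 * q dvd a * twist n r (k + q * i) + b * twist n r (l + q * j)"
      by (rule twist_shift_dvd[OF nq dvd[OF kl]])
    then obtain x y z where xyz:
      "a * twist n r (k + q * i) + b * twist n r (l + q * j) = q * (a * twist n n x + b * twist n n y + c * twist n n z)"
      using represents_twists_two[OF rep adm _ ge] by blast
    have nonneg: "0 \<le> a * twist n n x" "0 \<le> b * twist n n y" "0 \<le> c * twist n n z"
      using twist_nonneg[of n] n abc by auto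
    have total: "a * twist n n x + b * twist n n y + c * twist n n z \<le> n * (18 * b)"
      using le q unfolding xyz by simp
    have "n * (18 * b) \<le> n * (18 * (T * a))" using T n by simp
    hence "a * twist n n x \<le> a * (n * (18 * T))"
      using total nonneg by (simp add: algebra_simps)
    hence x: "twist n n x \<le> n * (18 * T)" using abc by simp
    have "b * twist n n y \<le> b * (n * 18)" using total nonneg by (simp add: algebra_simps)
    hence y: "twist n n y \<le> n * 18" using abc by simp
    have "n * (18 * b) \<le> n * (18 * c)" using abc n by simp
    hence "c * twist n n z \<le> c * (n * 18)" using total nonneg by (simp add: algebra_simps)
    hence z: "twist n n z \<le> n * 18" using abc by simp
    have "n * 18 \<le> n * (18 * T)" using n T1 by simp
    hence "\<bar>y\<bar> \<le> R" "\<bar>z\<bar> \<le> R" using y z le_R order_trans by blast+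
    hence "(x, y, z) \<in> Box"
      using le_R[OF x] by (auto simp: Box_def)
    thus ?thesis using xyz by (intro bexI[of _ "(x, y, z)"]) (simp_all add: val_def)
  qed
  define W where "W = (\<lambda>k l i j. SOME w. w \<in> Box \<and> a * twist n r (k + q * i) + b * twist n r (l + q * j) = val w)"
  have W: "W k l i j \<in> Box" "a * twist n r (k + q * i) + b * twist n r (l + q * j) = val (W k l i j)"
    if "(k, l) \<in> S" "i \<in> {1, 2}" "j \<in> {1, 2}" for k l i j
    using someI_ex[OF ex[OF that, unfolded Bex_def]] unfolding W_def by blast+
  define f where "f = (\<lambda>(k, l). (W k l 1 1, W k l 2 1, W k l 1 2))"
  have "inj_on f S"
  proof (rule inj_onI, clarify)
    fix k l k' l' assume kl: "(k, l) \<in> S" "(k', l') \<in> S" and eq: "f (k, l) = f (k', l')"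
    \<comment> \<open>This difference is linear in t with slope 2 q r > 0, so it determines
      t.\<close>
    have diff: "twist n r (t + q * 2) - twist n r (t + q * 1) = q * (2 * r * t + 2 * n + 2)" for t
      unfolding twist_shift[OF nq] by (simp add: twist_def algebra_simps)
    note W' = W(2)[OF kl(1)] W(2)[OF kl(2)]
    have vals: "val (W k l i j) = val (W k' l' i j)" if "(i, j) \<in> {(1, 1), (2, 1), (1, 2)}" for i j
      using eq that by (auto simp: f_def)
    have "a * (twist n r (k + q * 2) - twist n r (k + q * 1)) = a * (twist n r (k' + q * 2) - twist n r (k' + q * 1))"
      using W'(1)[of 1 1] W'(1)[of 2 1] W'(2)[of 1 1] W'(2)[of 2 1] vals[of 1 1] vals[of 2 1]
      unfolding right_diff_distrib by simp
    moreover have "b * (twist n r (l + q * 2) - twist n r (l + q * 1)) = b * (twist n r (l' + q * 2) - twist n r (l' + q * 1))"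
      using W'(1)[of 1 1] W'(1)[of 1 2] W'(2)[of 1 1] W'(2)[of 1 2] vals[of 1 1] vals[of 1 2]
      unfolding right_diff_distrib by simp
    ultimately show "k = k' \<and> l = l'" unfolding diff using abc q r by simp
  qed
  moreover have "f ` S \<subseteq> Box \<times> Box \<times> Box" using W(1) by (auto simp: f_def)
  moreover have "finite Box" by (simp add: Box_def)
  ultimately have "card S \<le> card (Box \<times> Box \<times> Box)" by (intro card_inj_on_le[of f]) auto
  \<comment> \<open>Three shifts with three coordinates each give nine coordinates in
    \<open>{-R..R}\<close>.\<close>
  also have "\<dots> = nat (2 * R + 1) ^ 9" by (simp add: Box_def card_cartesian_product power_numeral_reduce)
  finally show ?thesis using T1 by (simp add: R_def nat_power_eq[symmetric] le_nat_iff)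
qed

section \<open>Large ratio of the two smallest coefficients\<close>

text \<open>Two chords with the same vector (d, e) give three relations whose elimination shows that
  the line through their starting points is parallel to an asymptote. Such a line meets X^2 - Y^2 =
  E in two points only if E = 0. Positivity allows cancelling d (I + d).\<close>

lemma hyperbola_chord_unique:
  fixes X1 :: int
  assumes E: "X1\<^sup>2 - Y1\<^sup>2 = E" "X2\<^sup>2 - Y2\<^sup>2 = E"
    "(X1 + d)\<^sup>2 - (Y1 + e)\<^sup>2 = E" "(X2 + d)\<^sup>2 - (Y2 + e)\<^sup>2 = E"
    and pos: "X1 > 0" "X2 > 0" "d > 0" and "E \<noteq> 0"
  shows "X1 = X2"
proof (rule ccontr)
  assume neq: "X1 \<noteq> X2"
  define \<alpha> \<beta> I W where "\<alpha> = X1 - X2" and "\<beta> = Y1 - Y2" and "I = X1 + X2" and "W = Y1 + Y2"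
  have 1: "\<alpha> * d = \<beta> * e" and 2: "\<alpha> * I = \<beta> * W" and 3: "d * (I + d) = e * (W + e)"
    using E by (simp_all add: \<alpha>_def \<beta>_def I_def W_def power2_eq_square algebra_simps)
  have "\<beta>\<^sup>2 * (d * (I + d)) = \<beta> * e * (\<beta> * W + \<beta> * e)"
    unfolding 3 by (simp add: power2_eq_square algebra_simps)
  also have "\<dots> = \<alpha>\<^sup>2 * (d * (I + d))"
    unfolding 1[symmetric] 2[symmetric] by (simp add: power2_eq_square algebra_simps)
  finally have "\<beta>\<^sup>2 = \<alpha>\<^sup>2" using pos by (simp add: I_def)
  hence "\<beta> = \<alpha> \<or> \<beta> = - \<alpha>" by (simp add: power2_eq_iff)
  moreover have "\<alpha> \<noteq> 0" using neq by (simp add: \<alpha>_def)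
  ultimately have "W = I \<and> \<beta> = \<alpha> \<or> W = - I \<and> \<beta> = - \<alpha>" by (metis 2 minus_mult_commute mult_left_cancel minus_minus)
  hence "X1\<^sup>2 = Y1\<^sup>2"
  proof
    assume "W = I \<and> \<beta> = \<alpha>"
    hence "X1 = Y1" by (simp add: \<alpha>_def \<beta>_def I_def W_def)
    thus ?thesis by simp
  next
    assume "W = - I \<and> \<beta> = - \<alpha>"
    hence "X1 = - Y1" by (simp add: \<alpha>_def \<beta>_def I_def W_def)
    thus ?thesis by simp
  qed
  thus False using E(1) \<open>E \<noteq> 0\<close> by simp
qed

lemma twist_square: "4 * r * twist n r k = (2 * r * k - n + 2)\<^sup>2 - (n - 2)\<^sup>2"
  by (simp add: twist_def power2_eq_square algebra_simps)

text \<open>Completing squares with \<open>twist_square\<close> turns the equation into f^2 - g^2 =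
  4 r E, and the shift (d, e) into (2 n d, 2 n e). The condition \<open>i \<ge> 1\<close> places f
  on the positive side.\<close>

lemma twist_chord_unique:
  assumes n: "n = q * r" "q > 0" "r > 0" and k: "k \<ge> 0" and pos: "i \<ge> 1" "j \<ge> 1" "d > 0" and "E \<noteq> 0"
    and E: "twist n r (k + q * i) - q * twist n n x = E" "twist n r (k + q * j) - q * twist n n y = E"
      "twist n r (k + q * (i + d)) - q * twist n n (x + e) = E"
      "twist n r (k + q * (j + d)) - q * twist n n (y + e) = E"
  shows "i = j"
proof -
  define f where "f i = 2 * r * (k + q * i) - n + 2" for i
  define g where "g x = 2 * n * x - n + 2" for x :: int
  have sq: "(f i)\<^sup>2 - (g x)\<^sup>2 = 4 * r * (twist n r (k + q * i) - q * twist n n x)" for i x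
    using twist_square[of r n "k + q * i"] twist_square[of n n x]
    by (simp add: f_def g_def n(1) algebra_simps)
  have add: "f (i + d) = f i + 2 * n * d" "g (x + e) = g x + 2 * n * e" for i x
    by (simp_all add: f_def g_def n(1) algebra_simps)
  have f: "f i > 0" if "i \<ge> 1" for i
  proof -
    have "q * 1 \<le> q * i" using that n by (intro mult_left_mono) auto
    hence "q \<le> k + q * i" using k by linarith
    hence "r * q \<le> r * (k + q * i)" using n by (intro mult_left_mono) auto
    moreover have "r * q > 0" using n by simp
    ultimately show ?thesis unfolding f_def n(1) by (simp add: mult.commute[of q r])
  qed
  have "f i = f j"
    by (rule hyperbola_chord_unique[of _ "g x" "4 * r * E" _ "g y" "2 * n * d" "2 * n * e"])
       (use sq[of i x] sq[of j y] sq[of "i + d" "x + e"] sq[of "j + d" "y + e"] E add f pos n \<open>E \<noteq> 0\<close> in auto)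
  thus ?thesis using n by (simp add: f_def)
qed

lemma twist_abs_mono:
  assumes n: "n \<ge> 2" and sgn: "x > 0 \<longleftrightarrow> y > 0" and le: "\<bar>y\<bar> \<le> \<bar>x\<bar>"
  shows "twist n n y \<le> twist n n x"
proof (cases "x > 0")
  case True
  hence *: "0 < y" "y \<le> x" using sgn le by auto
  hence "n * 1 \<le> n * y" "n * y \<le> n * x" using n by (auto intro!: mult_left_mono)
  thus ?thesis unfolding twist_def using * n by (intro mult_mono) auto
next
  case False
  hence *: "0 \<le> - y" "- y \<le> - x" using sgn le by auto
  hence "0 \<le> n * (- y)" "n * (- y) \<le> n * (- x)" using n by (auto intro!: mult_left_mono simp: mult_le_0_iff)
  hence "(- y) * (n * (- y) + n - 2) \<le> (- x) * (n * (- x) + n - 2)" using * n by (intro mult_mono) auto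
  thus ?thesis by (simp add: twist_def algebra_simps)
qed

text \<open>For constant 0 the hyperbola splits into two lines. On each of them k/q is congruent
  modulo 1 to a root 0 or (n - 2)/n of the polygonal polynomial, and \<open>0 \<le> k < q\<close>
  makes it that root. This excludes degenerate hyperbolas in \<open>ratio_le\<close>.\<close>

lemma twist_zero_offset:
  assumes n: "n = q * r" "n \<ge> 3" "q > 0" and k: "0 \<le> k" "k < q"
    and eq: "twist n r (k + q * i) = q * twist n n x"
  shows "twist n r k = 0"
proof -
  have r: "r > 0" using n zero_less_mult_pos[of q r] by linarith
  define u where "u = k + q * i"
  have "(u - q * x) * (r * (u + q * x) - (n - 2)) = twist n r u - q * twist n n x"
    by (simp add: twist_def n(1) algebra_simps)
  also have "\<dots> = 0" using eq by (simp add: u_def)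
  finally consider "u = q * x" | "r * (u + q * x) = n - 2" by auto
  thus ?thesis
  proof cases
    case 1
    hence "k = q * (x - i)" by (simp add: u_def algebra_simps)
    hence "q dvd k" by simp
    hence "k = 0" using k by (metis dvd_imp_le_int abs_of_nonneg linorder_not_less abs_of_pos n(3))
    thus ?thesis by (simp add: twist_def)
  next
    case 2
    hence "r * k + 2 = n * (1 - i - x)" by (simp add: u_def n(1) algebra_simps)
    hence dvd: "n dvd r * k + 2" by simp
    have "r * k \<le> r * (q - 1)" using k r by (intro mult_left_mono) auto
    hence le: "r * k \<le> n - r" by (simp add: n(1) algebra_simps)
    have ge: "0 \<le> r * k" using k r by simp
    obtain t where t: "r * k + 2 = n * t" using dvd by blast
    have "n * t < n * 2" using le ge r n(2) unfolding t[symmetric] by linarith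
    hence "t < 2" using n(2) by simp
    have "0 < n * t" using ge unfolding t[symmetric] by linarith
    hence "t > 0" using n(2) by (simp add: zero_less_mult_iff)
    hence "t = 1" using \<open>t < 2\<close> by simp
    thus ?thesis using t by (simp add: twist_def)
  qed
qed

text \<open>\<rho> is the ceiling of sqrt (b / a), taken as a least integer; the integer b itself
  shows that one exists.\<close>

lemma ceiling_sqrt_ratio:
  fixes a b :: int
  assumes "a > 0" "b > 0"
  obtains \<rho> where "\<rho> \<ge> 1" "b \<le> a * \<rho>\<^sup>2" "a * (\<rho> - 1)\<^sup>2 < b"
proof -
  define m where "m = (LEAST m. b \<le> a * (int m)\<^sup>2)"
  have "b * 1 \<le> b * (a * b)" using assms by (intro mult_left_mono) (auto simp: int_one_le_iff_zero_less)
  hence "b \<le> a * (int (nat b))\<^sup>2" using assms by (simp add: power2_eq_square algebra_simps)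
  hence m: "b \<le> a * (int m)\<^sup>2" unfolding m_def by (rule LeastI)
  have "m \<noteq> 0" using m assms by (cases "m = 0") auto
  hence "\<not> b \<le> a * (int (m - 1))\<^sup>2" unfolding m_def by (intro not_less_Least) auto
  thus ?thesis using that[of "int m"] m \<open>m \<noteq> 0\<close> by simp
qed

text \<open>The count at the end yields \<open>\<rho> \<le> 1444 * (1 + K)\<close>, which is below 3
  * 10^11; the constant 10^24 forces \<rho> > 10^12. The last hypothesis keeps the hyperbolas
  nondegenerate.\<close>

lemma ratio_le:
  assumes rep: "represents_twists n a b c" and adm: "admissible n q r" and n: "n \<ge> 3"
    and abc: "0 < a" "a \<le> b" "b \<le> c"
    and k: "0 \<le> k" "k < q" and l: "0 \<le> l" "l < q"
    and dvd: "2 * q dvd a * twist n r k + b * twist n r l"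
    and nontrivial: "twist n r k \<noteq> 0 \<or> twist n r l \<noteq> 0"
  shows "b \<le> 10 ^ 24 * a"
proof (rule ccontr)
  assume "\<not> b \<le> 10 ^ 24 * a"
  hence large: "10 ^ 24 * a < b" by simp
  have nq: "n = q * r" and q: "q > 0" using admissibleD[OF adm] by auto
  have r: "r > 0" using n q nq zero_less_mult_pos[of q r] by linarith
  obtain \<rho> where \<rho>: "\<rho> \<ge> 1" "b \<le> a * \<rho>\<^sup>2" "a * (\<rho> - 1)\<^sup>2 < b"
    using ceiling_sqrt_ratio[of a b] abc by auto
  have \<rho>_large: "\<rho> > 10 ^ 12"
  proof (rule ccontr)
    assume "\<not> \<rho> > 10 ^ 12"
    hence "\<rho>\<^sup>2 \<le> (10 ^ 12)\<^sup>2" using \<rho>(1) by (intro power_mono) auto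
    hence "a * \<rho>\<^sup>2 \<le> a * 10 ^ 24" using abc by simp
    thus False using large \<rho>(2) by simp
  qed
  have "\<rho>\<^sup>2 \<le> (2 * (\<rho> - 1))\<^sup>2" using \<rho>_large by (intro power_mono) auto
  hence "\<rho>\<^sup>2 \<le> 4 * (\<rho> - 1)\<^sup>2" by (simp only: power_mult_distrib) simp
  hence "a * \<rho>\<^sup>2 \<le> a * (4 * (\<rho> - 1)\<^sup>2)" using abc by (intro mult_left_mono) auto
  hence \<rho>4: "a * \<rho>\<^sup>2 \<le> 4 * b" using \<rho>(3) by simp

  \<comment> \<open>Shifts beyond \<rho> make the a-term at least q n a \<rho>^2 >= q n b, which
    outweighs a negative b-term >= - q n b. Stopping at 2 \<rho> keeps the sum of order q n
    b.\<close>
  define I where "I = {\<rho> + 1..2 * \<rho>}"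
  \<comment> \<open>The constant of the hyperbola through (i, x); the representation makes it a
    function of (y, z).\<close>
  define E where "E = (\<lambda>i x. twist n r (k + q * i) - q * twist n n x)"
  have arg: "q * \<rho> \<le> k + q * i" "k + q * i \<le> 3 * (q * \<rho>)" "n * \<rho> \<le> r * (k + q * i) - n + 2"
    "r * (k + q * i) - n + 2 \<le> 3 * (n * \<rho>)" if "i \<in> I" for i
  proof -
    have "q * (\<rho> + 1) \<le> q * i" "q * i \<le> q * (2 * \<rho>)" "q * 1 \<le> q * \<rho>"
      using that q \<rho>(1) unfolding I_def by (auto intro!: mult_left_mono)
    hence u: "q * \<rho> + q \<le> k + q * i" "k + q * i \<le> 3 * (q * \<rho>)"
      using k unfolding distrib_left by linarith+
    have "r * (q * \<rho> + q) \<le> r * (k + q * i)" "r * (k + q * i) \<le> r * (3 * (q * \<rho>))"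
      using u r by (intro mult_left_mono; linarith)+
    moreover have "r * (q * \<rho> + q) = n * \<rho> + n" "r * (3 * (q * \<rho>)) = 3 * (n * \<rho>)"
      by (simp_all add: nq algebra_simps)
    ultimately show "n * \<rho> \<le> r * (k + q * i) - n + 2" "r * (k + q * i) - n + 2 \<le> 3 * (n * \<rho>)"
      using n by linarith+
    show "q * \<rho> \<le> k + q * i" "k + q * i \<le> 3 * (q * \<rho>)" using u q by linarith+
  qed
  have pos: "0 < q * \<rho>" "0 < n * \<rho>" using q n \<rho>(1) by simp_all
  have Fl: "- (n * q) \<le> twist n r l" "twist n r l < q"
  proof -
    have "r * l \<le> r * (q - 1)" using l r by (intro mult_left_mono) auto
    hence "r * l \<le> n - r" by (simp add: nq algebra_simps)
    hence le1: "r * l - n + 2 \<le> 1" using r by linarith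
    have "l * (r * l - n + 2) \<le> l * 1" using l le1 by (intro mult_left_mono) auto
    thus "twist n r l < q" using l by (simp add: twist_def)
    have "l * n \<le> q * n" "0 \<le> l * (r * l + 2)" using l n r by (auto intro!: mult_right_mono)
    thus "- (n * q) \<le> twist n r l" by (simp add: twist_def algebra_simps)
  qed
  \<comment> \<open>From a \<rho>^2 <= 4 b the y- and z-terms are bounded by 37 = 9 * 4 + 1, and 2 *
    37 <= 9^2. For x the bound is 2 * 10 \<rho>^2 <= (5 \<rho>)^2.\<close>
  have "\<exists>w. case w of (x, y, z) \<Rightarrow> \<bar>x\<bar> \<le> 5 * \<rho> \<and> y \<in> {-9..9} \<and> z \<in> {-9..9} \<and>
      a * E i x = q * (b * twist n n y + c * twist n n z) - b * twist n r l"
    if i: "i \<in> I" for i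
  proof -
    have T: "(q * \<rho>) * (n * \<rho>) \<le> twist n r (k + q * i)" "twist n r (k + q * i) \<le> (3 * (q * \<rho>)) * (3 * (n * \<rho>))"
      unfolding twist_def using arg[OF i] pos by (intro mult_mono; linarith)+
    have "a * ((q * \<rho>) * (n * \<rho>)) \<le> a * twist n r (k + q * i)"
      "a * twist n r (k + q * i) \<le> a * ((3 * (q * \<rho>)) * (3 * (n * \<rho>)))"
      "b * (- (n * q)) \<le> b * twist n r l" "b * twist n r l \<le> b * q"
      using T Fl abc by (intro mult_left_mono; linarith)+
    moreover have "a * ((q * \<rho>) * (n * \<rho>)) = q * n * (a * \<rho>\<^sup>2)"
      "a * ((3 * (q * \<rho>)) * (3 * (n * \<rho>))) = q * (9 * n * (a * \<rho>\<^sup>2))"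
      by (simp_all add: power2_eq_square)
    moreover have "b * (- (n * q)) = - (q * n * b)" "b * q = q * b" by simp_all
    moreover have "q * n * b \<le> q * n * (a * \<rho>\<^sup>2)" using \<rho>(2) q n by (intro mult_left_mono) auto
    ultimately have ge: "0 \<le> a * twist n r (k + q * i) + b * twist n r l"
      and le: "a * twist n r (k + q * i) + b * twist n r l \<le> q * (9 * n * (a * \<rho>\<^sup>2) + b)"
      unfolding distrib_left by (linarith, linarith)
    have "2 * q dvd a * twist n r (k + q * i) + b * twist n r (l + q * 0)"
      by (rule twist_shift_dvd[OF nq dvd])
    then obtain x y z where xyz:
      "a * twist n r (k + q * i) + b * twist n r l = q * (a * twist n n x + b * twist n n y + c * twist n n z)"
      using represents_twists_two[OF rep adm _ ge] by auto
    have nonneg: "0 \<le> a * twist n n x" "0 \<le> b * twist n n y" "0 \<le> c * twist n n z"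
      using twist_nonneg[of n] n abc by auto
    have total: "a * twist n n x + b * twist n n y + c * twist n n z \<le> 9 * n * (a * \<rho>\<^sup>2) + b"
      using le q unfolding xyz by simp
    have "1 * b \<le> n * b" "n * b \<le> n * (a * \<rho>\<^sup>2)" "n * (a * \<rho>\<^sup>2) \<le> n * (4 * b)" "n * b \<le> n * c"
      using n abc \<rho>(2) \<rho>4 by (auto intro!: mult_left_mono mult_right_mono)
    hence "a * twist n n x \<le> a * (n * (10 * \<rho>\<^sup>2))" "b * twist n n y \<le> b * (n * 37)" "c * twist n n z \<le> c * (n * 37)"
      using total nonneg by (simp_all add: algebra_simps)
    hence G: "twist n n x \<le> n * (10 * \<rho>\<^sup>2)" "twist n n y \<le> n * 37" "twist n n z \<le> n * 37"
      using abc by simp_all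
    have "1\<^sup>2 \<le> \<rho>\<^sup>2" using \<rho>(1) by (intro power_mono) auto
    hence "1 \<le> 10 * \<rho>\<^sup>2" by simp
    hence "\<bar>x\<bar> \<le> 5 * \<rho>"
      using \<rho>(1) n by (intro abs_le_of_twist_le[OF _ G(1)]) (auto simp: power_mult_distrib)
    moreover have "\<bar>y\<bar> \<le> 9" "\<bar>z\<bar> \<le> 9"
      using n by (auto intro!: abs_le_of_twist_le[OF _ G(2)] abs_le_of_twist_le[OF _ G(3)])
    moreover have "a * E i x = q * (b * twist n n y + c * twist n n z) - b * twist n r l"
      using xyz unfolding E_def by (simp add: algebra_simps)
    ultimately show ?thesis by (intro exI[of _ "(x, y, z)"]) auto
  qed
  hence "\<forall>i\<in>I. \<exists>w. case w of (x, y, z) \<Rightarrow> \<bar>x\<bar> \<le> 5 * \<rho> \<and> y \<in> {-9..9} \<and> z \<in> {-9..9} \<and>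
      a * E i x = q * (b * twist n n y + c * twist n n z) - b * twist n r l" by blast
  from bchoice[OF this] obtain w where w: "\<forall>i\<in>I. case w i of (x, y, z) \<Rightarrow> \<bar>x\<bar> \<le> 5 * \<rho> \<and> y \<in> {-9..9} \<and> z \<in> {-9..9} \<and>
      a * E i x = q * (b * twist n n y + c * twist n n z) - b * twist n r l" by blast
  define x y z where "x = fst \<circ> w" and "y = fst \<circ> snd \<circ> w" and "z = snd \<circ> snd \<circ> w"
  have x: "\<bar>x i\<bar> \<le> 5 * \<rho>" and yz: "y i \<in> {-9..9}" "z i \<in> {-9..9}"
    and aE: "a * E i (x i) = q * (b * twist n n (y i) + c * twist n n (z i)) - b * twist n r l" if "i \<in> I" for i
    using bspec[OF w that] by (simp_all add: x_def y_def z_def split: prod.splits)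
  \<comment> \<open>Equal (y, z) means the same hyperbola; the sign of x is added so that the
    absolute value of x increases along a label.\<close>
  define lab where "lab = (\<lambda>i. (x i > 0, y i, z i))"
  have E_lab: "E i (x i) = E j (x j)" if "i \<in> I" "j \<in> I" "lab i = lab j" for i j
  proof -
    have "a * E i (x i) = a * E j (x j)" using that by (simp add: aE lab_def)
    thus ?thesis using abc by simp
  qed
  \<comment> \<open>If the constant were 0, the y- and z-terms would total less than b and hence
    vanish. Then both \<open>twist n r l\<close> and, by \<open>twist_zero_offset\<close>,
    \<open>twist n r k\<close> would be 0.\<close>
  have E_nz: "E i (x i) \<noteq> 0" if i: "i \<in> I" for i
  proof
    assume "E i (x i) = 0"
    hence eq: "q * (b * twist n n (y i) + c * twist n n (z i)) = b * twist n r l"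
      using aE[OF i] by simp
    have "b * twist n r l < b * q" using Fl abc by simp
    hence "q * (b * twist n n (y i) + c * twist n n (z i)) < q * b" by (simp add: eq mult.commute)
    hence lt: "b * twist n n (y i) + c * twist n n (z i) < b" using q by simp
    have 2: "c * 2 \<le> c * twist n n t \<or> twist n n t = 0" "b * 2 \<le> b * twist n n t \<or> twist n n t = 0"
      "0 \<le> c * twist n n t" "0 \<le> b * twist n n t" for t
      using twist_eq_0_or_ge_2[of n t] n abc by auto
    have "twist n n (y i) = 0" using lt 2(2)[of "y i"] 2(3)[of "z i"] abc by linarith
    moreover have "twist n n (z i) = 0" using lt 2(1)[of "z i"] 2(4)[of "y i"] abc by linarith
    ultimately have "twist n r l = 0" using eq abc by simp
    moreover have "twist n r k = 0"
      using twist_zero_offset[OF nq n q k] \<open>E i (x i) = 0\<close> by (simp add: E_def)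
    ultimately show False using nontrivial by simp
  qed
  \<comment> \<open>With \<open>E\<close> fixed, a larger i forces a larger
    \<open>twist n n x\<close>, and among arguments of one sign this means a larger absolute
    value.\<close>
  have mono: "\<bar>x i\<bar> < \<bar>x j\<bar>" if ij: "i \<in> I" "j \<in> I" "lab i = lab j" "i < j" for i j
  proof (rule ccontr)
    assume "\<not> \<bar>x i\<bar> < \<bar>x j\<bar>"
    hence "twist n n (x j) \<le> twist n n (x i)"
      using ij n by (intro twist_abs_mono) (auto simp: lab_def)
    hence "q * twist n n (x j) \<le> q * twist n n (x i)" using q by simp
    hence "twist n r (k + q * j) \<le> twist n r (k + q * i)"
      using E_lab[OF ij(1-3)] unfolding E_def by linarith
    moreover have "k + q * i < k + q * j" using ij q by simp
    moreover have "r * (k + q * i) < r * (k + q * j)" using ij q r by simp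
    ultimately show False
      using arg[OF ij(1)] pos mult_strict_mono[of "k + q * i" "k + q * j" "r * (k + q * i) - n + 2" "r * (k + q * j) - n + 2"]
      unfolding twist_def by linarith
  qed

  \<comment> \<open>Along the pairs \<open>(i, x i)\<close> with a given label, \<open>s\<close> increases. Cutting its range into blocks of
    length \<open>H\<close>, every \<open>i\<close> is either the last one of its block or determined by its label and a short
    difference vector. As there are at most \<open>2 * 19 * 19 = 722\<close> labels, the choice of \<open>H\<close> makes the
    first kind account for at most half of \<open>I\<close>.\<close>
  define s where "s = (\<lambda>i. i + \<bar>x i\<bar>)"
  define H :: int where "H = 14 * 722"
  define later where "later = (\<lambda>i j. j \<in> I \<and> lab j = lab i \<and> s i < s j \<and> s j div H = s i div H)"
  define nxt where "nxt = (\<lambda>i. SOME j. later i j)"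
  define code where "code = (\<lambda>i. (lab i,
    if \<exists>j. later i j then Inr (nxt i - i, x (nxt i) - x i) else Inl (s i div H)))"
  have code_Inl: "code i = (lab i, Inl (s i div H))" if "\<nexists>j. later i j" for i
    unfolding code_def using that by simp
  have code_Inr: "code i = (lab i, Inr (nxt i - i, x (nxt i) - x i))" if "\<exists>j. later i j" for i
    unfolding code_def using that by simp
  have nxt: "later i (nxt i)" if "\<exists>j. later i j" for i
    using someI_ex[OF that] by (simp add: nxt_def)
  have s_mono: "i < j \<longleftrightarrow> s i < s j" if "i \<in> I" "j \<in> I" "lab i = lab j" for i j
    using mono[OF that] mono[OF that(2,1) that(3)[symmetric]] unfolding s_def
    by (cases i j rule: linorder_cases) auto
  have "inj_on code I"
  proof (rule inj_onI)
    fix i j assume i: "i \<in> I" and j: "j \<in> I" and eq: "code i = code j"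
    have lab: "lab i = lab j" using eq by (simp add: code_def)
    show "i = j"
    proof (cases "\<exists>t. later i t")
      case False
      hence nj: "\<nexists>t. later j t" using eq code_Inl code_Inr[of j] by fastforce
      hence "s i div H = s j div H" using eq code_Inl[OF False] code_Inl[OF nj] by simp
      hence "\<not> s i < s j" "\<not> s j < s i" using False nj i j lab by (auto simp: later_def)
      thus ?thesis using s_mono[OF i j lab] s_mono[OF j i lab[symmetric]] by linarith
    next
      case True
      hence ex: "\<exists>t. later j t" using eq code_Inr code_Inl[of j] by fastforce
      \<comment> \<open>Equal codes give two chords of one hyperbola with the same vector (d, e), so
        their starting points agree.\<close>
      define d e where "d = nxt i - i" and "e = x (nxt i) - x i"
      have de: "nxt i = i + d" "x (nxt i) = x i + e" "nxt j = j + d" "x (nxt j) = x j + e"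
        using eq code_Inr[OF True] code_Inr[OF ex] by (simp_all add: d_def e_def)
      have xd: "x (i + d) = x i + e" "x (j + d) = x j + e" using de by simp_all
      note ni = nxt[OF True] and nj = nxt[OF ex]
      have "d > 0" using s_mono[OF i, of "nxt i"] ni by (auto simp: later_def d_def)
      have "E i (x i) = E j (x j)" "E (i + d) (x i + e) = E i (x i)" "E (j + d) (x j + e) = E i (x i)"
        using E_lab[OF i j lab] E_lab[of "nxt i" i] E_lab[of "nxt j" j] i j ni nj lab
        by (auto simp: later_def de(1,3) xd)
      thus ?thesis
        using \<rho>(1) i j unfolding E_def
        by (intro twist_chord_unique[OF nq q r k(1) _ _ \<open>d > 0\<close> E_nz[OF i], of i j "x i" "x j" e])
           (auto simp: I_def E_def)
    qed
  qed
  define Codes where "Codes = ((UNIV :: bool set) \<times> {-9..9::int} \<times> {-9..9::int}) \<times>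
     Sum_Type.Plus {0..(7 * \<rho>) div H} ({0..H} \<times> {-H..H})"
  have "code ` I \<subseteq> Codes"
  proof (intro image_subsetI)
    fix i assume i: "i \<in> I"
    \<comment> \<open>The 7 is 2 + 5, from i <= 2 \<rho> and the bound 5 \<rho> for x.\<close>
    have s_bd: "0 \<le> s t" "s t \<le> 7 * \<rho>" if "t \<in> I" for t
      using x[OF that] that \<rho>(1) by (auto simp: s_def I_def)
    show "code i \<in> Codes"
    proof (cases "\<exists>j. later i j")
      case False
      have "0 \<le> s i div H" "s i div H \<le> (7 * \<rho>) div H"
        using s_bd[OF i] by (auto simp: H_def intro: zdiv_mono1 pos_imp_zdiv_nonneg_iff[THEN iffD2])
      thus ?thesis using yz[OF i] by (auto simp: code_Inl[OF False] Codes_def lab_def)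
    next
      case True
      define j where "j = nxt i"
      have j: "j \<in> I" "lab j = lab i" "s i < s j" "s j div H = s i div H"
        using nxt[OF True] by (auto simp: later_def j_def)
      have "s j = H * (s i div H) + s j mod H" "s i = H * (s i div H) + s i mod H"
        using j(4) by (metis mult_div_mod_eq)+
      moreover have "s j mod H < H" "0 \<le> s i mod H" by (simp_all add: H_def)
      ultimately have lt: "s j - s i < H" by linarith
      have ij: "i < j" using s_mono[OF i j(1)] j by simp
      have "\<bar>x i\<bar> < \<bar>x j\<bar>" using mono[OF i j(1)] j ij by simp
      moreover have "x i > 0 \<longleftrightarrow> x j > 0" using j(2) by (simp add: lab_def)
      \<comment> \<open>Both i and the absolute value of x increase, so each increment is at most
        that of s, which is below H inside a block.\<close>
      ultimately have "0 \<le> j - i" "j - i \<le> H" "- H \<le> x j - x i" "x j - x i \<le> H"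
        using lt ij unfolding s_def by linarith+
      thus ?thesis using yz[OF i] by (auto simp: code_Inr[OF True] Codes_def lab_def j_def)
    qed
  qed
  moreover have "finite Codes" by (simp add: Codes_def)
  ultimately have "card I \<le> card Codes"
    using \<open>inj_on code I\<close> by (intro card_inj_on_le)
  hence "int (card I) \<le> int (card Codes)" by simp
  moreover have "int (card I) = \<rho>" using \<rho>(1) by (simp add: I_def)
  moreover define t K where "t = (7 * \<rho>) div H" and "K = (H + 1) * (2 * H + 1)"
  have "int (card Codes) = 722 * (t + 1 + K)"
    using \<rho>(1) by (simp add: Codes_def card_cartesian_product card_Plus H_def t_def K_def)
  \<comment> \<open>With H = 14 * 722, the 722 t codes of blocks other than the initial ones amount
    to at most \<rho> / 2.\<close>
  moreover have "14 * 722 * t \<le> 7 * \<rho>"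
    using mult_div_mod_eq[of H "7 * \<rho>"] pos_mod_sign[of H "7 * \<rho>"] unfolding t_def[symmetric]
    by (simp add: H_def)
  hence "1444 * t \<le> \<rho>" by simp
  ultimately have "2 * \<rho> \<le> \<rho> + 1444 * (1 + K)" by simp
  hence "\<rho> \<le> 1444 * (1 + K)" by simp
  thus False using \<rho>_large by (simp add: H_def K_def)
qed

section \<open>Points on the conic\<close>

text \<open>By Bezout a combination of the two coordinates recovers j modulo q.\<close>

lemma card_mod_image_pairs:
  fixes q u v :: int
  assumes q: "q > 0" and uv: "coprime u v"
  shows "card ((\<lambda>j. (j * u mod q, j * v mod q)) ` {0..<q}) = nat q"
proof -
  have "inj_on (\<lambda>j. (j * u mod q, j * v mod q)) {0..<q}"
  proof (rule inj_onI)
    fix i j assume ij: "i \<in> {0..<q}" "j \<in> {0..<q}" and "(i * u mod q, i * v mod q) = (j * u mod q, j * v mod q)"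
    hence *: "q dvd (i - j) * u" "q dvd (i - j) * v"
      unfolding prod.inject mod_eq_dvd_iff left_diff_distrib by blast+
    obtain s t where "s * u + t * v = 1" using bezout_int[of u v] uv by auto
    hence "i - j = (i - j) * (s * u + t * v)" by simp
    also have "\<dots> = s * ((i - j) * u) + t * ((i - j) * v)" by (simp add: algebra_simps)
    finally have "q dvd i - j" using * by (metis dvd_add dvd_mult)
    hence "i mod q = j mod q" by (simp add: mod_eq_dvd_iff)
    thus "i = j" using ij by simp
  qed
  thus ?thesis by (simp add: card_image)
qed

text \<open>Since twist is r k (k - q) + 2 k and 2 q divides the first term, the conic degenerates
  to the line a k + b l = 0 modulo q, which contains the multiples of (b/g, -a/g). The parity
  condition supplies the factor 2: for odd q the product k (k - q) is even.\<close>

lemma integral_pairs_square: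
  assumes n: "n = q * r" and q: "q > 0" "q dvd r" "odd q \<or> 2 * q dvd r" and ab: "a > 0" "b > 0"
  obtains S where "S \<subseteq> {0..<q} \<times> {0..<q}" "int (card S) = q"
    "\<And>k l. (k, l) \<in> S \<Longrightarrow> 2 * q dvd a * twist n r k + b * twist n r l"
proof -
  define g u v where "g = gcd a b" and "u = b div g" and "v = - (a div g)"
  have g: "b = g * u" "a = g * (- v)" by (simp_all add: g_def u_def v_def)
  have "coprime u v" using ab div_gcd_coprime[of a b] by (simp add: u_def v_def g_def coprime_commute)
  define S where "S = (\<lambda>j. (j * u mod q, j * v mod q)) ` {0..<q}"
  have half: "2 * q dvd r * (k * (k - q))" for k
  proof (cases "2 * q dvd r")
    case False
    hence "2 dvd k * (k - q)" using q(3) by simp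
    thus ?thesis using mult_dvd_mono[OF _ q(2)] by (metis mult.commute)
  qed simp
  have "2 * q dvd a * twist n r k + b * twist n r l" if kl: "(k, l) \<in> S" for k l
  proof -
    obtain j where j: "k = j * u mod q" "l = j * v mod q" using kl unfolding S_def by blast
    have "q dvd k - j * u" "q dvd l - j * v" unfolding j by (simp_all add: mod_eq_dvd_iff[symmetric])
    moreover have "a * k + b * l = a * (k - j * u) + b * (l - j * v)" unfolding g by (simp add: algebra_simps)
    ultimately have "q dvd a * k + b * l" by simp
    hence "2 * q dvd a * (r * (k * (k - q))) + b * (r * (l * (l - q))) + 2 * (a * k + b * l)"
      by (rule dvd_add[OF dvd_add[OF dvd_mult[OF half] dvd_mult[OF half]] mult_dvd_mono[OF dvd_refl]])
    thus ?thesis by (simp add: twist_def n algebra_simps)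
  qed
  moreover have "int (card S) = q" using card_mod_image_pairs[OF q(1) \<open>coprime u v\<close>] q(1) by (simp add: S_def)
  moreover have "S \<subseteq> {0..<q} \<times> {0..<q}" using q(1) by (auto simp: S_def)
  ultimately show ?thesis using that by blast
qed

lemma card_le_1I: "(\<And>x y. x \<in> A \<Longrightarrow> y \<in> A \<Longrightarrow> x = y) \<Longrightarrow> card A \<le> 1"
  by (cases "finite A") (simp_all add: card_le_Suc0_iff_eq)

text \<open>Modulo a prime \<open>p\<close> the integrality condition describes a conic through \<open>(0, 0)\<close>, which is
  parametrised by the slopes \<open>t\<close> of the lines through that point.\<close>

lemma integral_pairs_prime:
  fixes p :: int
  assumes n: "n = p * r" and p: "prime p" "odd p" "\<not> p dvd r"
  obtains S where "S \<subseteq> {0..<p} \<times> {0..<p}" "2 * int (card S) + 4 \<ge> p"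
    "\<And>k l. (k, l) \<in> S \<Longrightarrow> 2 * p dvd a * twist n r k + b * twist n r l"
proof -
  have p1: "p > 1" using p(1) prime_gt_1_int by blast
  \<comment> \<open>The factor 2 is automatic because p is odd, and the term with n drops out modulo
    p.\<close>
  have dvdI: "2 * p dvd a * twist n r k + b * twist n r l"
    if "p dvd a * (k * (r * k + 2)) + b * (l * (r * l + 2))" for k l
  proof -
    have "2 dvd twist n r t" for t using p(2) by (auto simp: twist_def n)
    hence "2 dvd a * twist n r k + b * twist n r l" by simp
    moreover have "a * twist n r k + b * twist n r l
        = a * (k * (r * k + 2)) + b * (l * (r * l + 2)) - p * (r * (a * k + b * l))"
      by (simp add: twist_def n algebra_simps)
    hence "p dvd a * twist n r k + b * twist n r l" using that by simp
    moreover have "coprime 2 p" using p(2) by simp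
    ultimately show ?thesis by (intro divides_mult)
  qed
  show ?thesis
  proof (cases "p dvd b")
    \<comment> \<open>If p divides b, the whole line k = 0 lies on the conic.\<close>
    case True
    show ?thesis
    proof (rule that[of "{0} \<times> {0..<p}"])
      show "2 * p dvd a * twist n r k + b * twist n r l" if "(k, l) \<in> {0} \<times> {0..<p}" for k l
        using that True by (intro dvdI) simp
    qed (use p1 in \<open>auto simp: card_cartesian_product\<close>)
  next
    case False
    define h where "h = (p - 1) div 2"
    have h: "p = 2 * h + 1" using p(2) by (auto simp: h_def elim!: oddE)
    \<comment> \<open>Slopes are restricted to 0..h so that their squares are distinct modulo p.
      \<open>B1\<close> has the slopes for which the quadratic coefficient vanishes,
      \<open>B2\<close> the tangent at the origin, whose second intersection is the origin again. At
      most two slopes are lost, which leaves h - 1.\<close>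
    define B1 where "B1 = {t \<in> {0..h}. p dvd a + b * t\<^sup>2}"
    define B2 where "B2 = {t \<in> {0..h}. p dvd a + b * t}"
    define \<Lambda> where "\<Lambda> = {0..h} - (B1 \<union> B2)"
    have small: "s = t" if "p dvd s - t" "s \<in> {0..h}" "t \<in> {0..h}" for s t
      using that h by (metis atLeastAtMost_iff mod_eq_dvd_iff mod_pos_pos_trivial
          add_increasing2 le_less_trans zless_add1_eq mult_2 order_le_less linorder_not_less)
    have "card B1 \<le> 1"
    proof (rule card_le_1I)
      fix s t assume st: "s \<in> B1" "t \<in> B1"
      hence "p dvd (a + b * s\<^sup>2) - (a + b * t\<^sup>2)" unfolding B1_def by (blast intro: dvd_diff)
      also have "(a + b * s\<^sup>2) - (a + b * t\<^sup>2) = b * ((s - t) * (s + t))"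
        by (simp add: power2_eq_square algebra_simps)
      finally have "p dvd s - t \<or> p dvd s + t" using False p(1) by (simp add: prime_dvd_mult_iff)
      thus "s = t"
      proof
        assume "p dvd s + t"
        moreover have "0 \<le> s + t" "s + t < p" "0 \<le> s" "0 \<le> t" using st h by (auto simp: B1_def)
        ultimately have "s + t = 0" using zdvd_not_zless[of "s + t" p] by linarith
        thus ?thesis using st by (auto simp: B1_def)
      qed (use small st in \<open>auto simp: B1_def\<close>)
    qed
    moreover have "card B2 \<le> 1"
    proof (rule card_le_1I)
      fix s t assume st: "s \<in> B2" "t \<in> B2"
      hence "p dvd (a + b * s) - (a + b * t)" unfolding B2_def by (blast intro: dvd_diff)
      also have "(a + b * s) - (a + b * t) = b * (s - t)" by (simp add: algebra_simps)
      finally have "p dvd s - t" using False p(1) by (simp add: prime_dvd_mult_iff)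
      thus "s = t" using small st by (auto simp: B2_def)
    qed
    moreover have "card (B1 \<union> B2) \<le> card B1 + card B2" by (rule card_Un_le)
    moreover have sub: "B1 \<union> B2 \<subseteq> {0..h}" by (auto simp: B1_def B2_def)
    hence "finite (B1 \<union> B2)" by (rule finite_subset) simp
    hence "card \<Lambda> = card {0..h} - card (B1 \<union> B2)"
      unfolding \<Lambda>_def by (rule card_Diff_subset[OF _ sub])
    moreover have "int (card {0..h}) = h + 1" using h p1 by simp
    ultimately have card: "int (card \<Lambda>) \<ge> h - 1" by linarith
    have "\<exists>k. \<not> p dvd k \<and> k \<in> {0..<p} \<and> p dvd r * (a + b * t\<^sup>2) * k + 2 * (a + b * t)" if t: "t \<in> \<Lambda>" for t
    proof -
      have nd: "\<not> p dvd a + b * t\<^sup>2" "\<not> p dvd a + b * t" using t by (auto simp: \<Lambda>_def B1_def B2_def)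
      define w where "w = r * (a + b * t\<^sup>2)"
      have "\<not> p dvd w" using nd p by (simp add: w_def prime_dvd_mult_iff)
      hence "coprime w p" using p(1) by (metis coprime_commute prime_imp_coprime)
      then obtain x y where xy: "x * w + y * p = 1" using bezout_int[of w p] by auto
      \<comment> \<open>The first coordinate of the second intersection with the line l = t k, with
        x as the inverse of w modulo p.\<close>
      define k where "k = (- 2 * (a + b * t) * x) mod p"
      have "(w * k + 2 * (a + b * t)) mod p = (w * (- 2 * (a + b * t) * x) + 2 * (a + b * t)) mod p"
        unfolding k_def by (metis mod_add_left_eq mod_mult_right_eq)
      also have "w * (- 2 * (a + b * t) * x) + 2 * (a + b * t) = 2 * (a + b * t) * (1 - x * w)"
        by (simp add: algebra_simps)
      also have "1 - x * w = y * p" using xy by simp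
      finally have dvd: "p dvd w * k + 2 * (a + b * t)" by (simp add: mod_0_imp_dvd)
      have "\<not> p dvd k"
      proof
        assume "p dvd k"
        hence "p dvd 2 * (a + b * t)" using dvd by (simp add: dvd_add_right_iff)
        hence "p dvd 2" using nd(2) prime_dvd_multD[OF p(1)] by blast
        hence "p \<le> 2" by (simp add: zdvd_imp_le)
        thus False using p1 p(2) by (cases "p = 2") auto
      qed
      thus ?thesis using dvd p1 by (intro exI[of _ k]) (simp add: w_def k_def)
    qed
    then obtain \<kappa> where \<kappa>: "\<And>t. t \<in> \<Lambda> \<Longrightarrow> \<not> p dvd \<kappa> t" "\<And>t. t \<in> \<Lambda> \<Longrightarrow> \<kappa> t \<in> {0..<p}"
      "\<And>t. t \<in> \<Lambda> \<Longrightarrow> p dvd r * (a + b * t\<^sup>2) * \<kappa> t + 2 * (a + b * t)" by metis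
    define f where "f = (\<lambda>t. (\<kappa> t, (t * \<kappa> t) mod p))"
    have "inj_on f \<Lambda>"
    proof (rule inj_onI)
      fix s t assume st: "s \<in> \<Lambda>" "t \<in> \<Lambda>" and eq: "f s = f t"
      from eq have "\<kappa> s = \<kappa> t \<and> (s * \<kappa> s) mod p = (t * \<kappa> t) mod p"
        unfolding f_def prod.inject .
      hence "(s * \<kappa> t) mod p = (t * \<kappa> t) mod p" by metis
      hence "p dvd (s - t) * \<kappa> t" by (simp add: mod_eq_dvd_iff left_diff_distrib)
      hence "p dvd s - t" using \<kappa>(1)[OF st(2)] p(1) by (simp add: prime_dvd_mult_iff)
      thus "s = t" using small st by (auto simp: \<Lambda>_def)
    qed
    hence "card (f ` \<Lambda>) = card \<Lambda>" by (rule card_image)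
    have "2 * p dvd a * twist n r k + b * twist n r l" if "(k, l) \<in> f ` \<Lambda>" for k l
    proof -
      obtain t where t: "t \<in> \<Lambda>" "k = \<kappa> t" "l = (t * k) mod p" using \<open>(k, l) \<in> f ` \<Lambda>\<close> by (auto simp: f_def)
      have "a * (k * (r * k + 2)) + b * (l * (r * l + 2)) = k * (r * (a + b * t\<^sup>2) * k + 2 * (a + b * t))
          + b * ((l - t * k) * (r * (l + t * k) + 2))"
        by (simp add: power2_eq_square algebra_simps)
      moreover have "p dvd r * (a + b * t\<^sup>2) * k + 2 * (a + b * t)" using \<kappa>(3)[OF t(1)] t(2) by simp
      moreover have "p dvd l - t * k" unfolding t(3) by (simp add: mod_eq_dvd_iff[symmetric])
      ultimately show ?thesis by (intro dvdI) simp
    qed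
    moreover have "f ` \<Lambda> \<subseteq> {0..<p} \<times> {0..<p}" using \<kappa>(2) p1 by (auto simp: f_def)
    moreover have "2 * int (card (f ` \<Lambda>)) + 4 \<ge> p"
      unfolding \<open>card (f ` \<Lambda>) = card \<Lambda>\<close> using card h by linarith
    ultimately show ?thesis by (intro that[of "f ` \<Lambda>"])
  qed
qed

section \<open>Choice of the denominator\<close>

text \<open>Otherwise n has at most M prime divisors, each contributing a power of at most M^4. The
  exponent 2 f + 1 instead of 2 f provides the extra factor 2 that the prime 2 requires.\<close>

lemma large_prime_or_prime_power_divisor:
  fixes n M :: nat
  assumes "n > (M ^ 4) ^ M"
  obtains p where "prime p" "p \<ge> M" "p dvd n" | p f where "prime p" "p ^ f \<ge> M" "p ^ (2 * f + 1) dvd n"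
proof (rule ccontr)
  assume contra: "\<not> thesis"
  have M: "p < M" if "p \<in> prime_factors n" for p
    using that contra \<open>\<And>p. \<lbrakk>prime p; M \<le> p; p dvd n\<rbrakk> \<Longrightarrow> thesis\<close>
    by (metis in_prime_factors_iff linorder_not_less)
  have n0: "n \<noteq> 0" using assms by auto
  have le: "p ^ multiplicity p n \<le> M ^ 4" if p: "p \<in> prime_factors n" for p
  proof -
    \<comment> \<open>The largest f with 2 f + 1 <= e; hence p^e <= (p^f p)^2 with both factors
      below M.\<close>
    define e f where "e = multiplicity p n" and "f = (e - 1) div 2"
    have "prime p" "p dvd n" using p by auto
    hence "e > 0" using n0 by (simp add: e_def prime_multiplicity_gt_zero_iff)
    hence ef: "2 * f + 1 \<le> e" "e \<le> 2 * f + 2" by (auto simp: f_def)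
    hence "p ^ (2 * f + 1) dvd n" unfolding e_def by (intro multiplicity_dvd')
    hence "p ^ f < M"
      using contra \<open>\<And>p f. \<lbrakk>prime p; M \<le> p ^ f; p ^ (2 * f + 1) dvd n\<rbrakk> \<Longrightarrow> thesis\<close> \<open>prime p\<close>
      by (meson linorder_not_less)
    have "p ^ e \<le> p ^ (2 * f + 2)" using ef(2) prime_ge_1_nat[OF \<open>prime p\<close>] by (intro power_increasing)
    also have "\<dots> = (p ^ f * p) ^ 2" by (simp only: power_Suc2[symmetric] power_mult[symmetric]) (simp add: mult.commute)
    also have "\<dots> \<le> (M * M) ^ 2" using \<open>p ^ f < M\<close> M[OF p] by (intro power_mono mult_mono) auto
    also have "\<dots> = M ^ 4" by (simp add: power_numeral_reduce)
    finally show ?thesis unfolding e_def .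
  qed
  have "n = (\<Prod>p\<in>prime_factors n. p ^ multiplicity p n)" using n0 by (simp add: prod_prime_factors)
  also have "\<dots> \<le> (\<Prod>p\<in>prime_factors n. M ^ 4)" using le by (intro prod_mono) auto
  also have "\<dots> = (M ^ 4) ^ card (prime_factors n)" by simp
  also have "\<dots> \<le> (M ^ 4) ^ M"
  proof (cases "M = 0")
    case True
    hence "prime_factors n = {}" using M by auto
    thus ?thesis using True by simp
  next
    case False
    have "card (prime_factors n) \<le> card {..<M}" using M by (intro card_mono) auto
    thus ?thesis using False by (intro power_increasing) auto
  qed
  finally show False using assms by simp
qed

text \<open>The denominator is chosen from n alone, before a and b. The estimate for S is the weaker
  one of the prime case, so that it also covers prime powers.\<close>

lemma many_integral_pairs:
  fixes M :: nat
  assumes M: "M \<ge> 3" and n: "n > int ((M ^ 4) ^ M)"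
  obtains q r where "admissible n q r"
    "\<And>a b. a > 0 \<Longrightarrow> b > 0 \<Longrightarrow> \<exists>S \<subseteq> {0..<q} \<times> {0..<q}. 2 * int (card S) + 4 \<ge> int M \<and>
       (\<forall>(k, l) \<in> S. 2 * q dvd a * twist n r k + b * twist n r l)"
proof -
  note admissible_pairs = that
  have n0: "n > 0" using n by (meson le_less_trans of_nat_0_le_iff)
  have square: thesis
    if p: "prime p" and f: "p ^ f \<ge> M" and dvd: "int (p ^ (2 * f)) dvd n" and odd: "odd p \<or> int (2 * p ^ (2 * f)) dvd n" for p f
  proof -
    define q where "q = int (p ^ f)"
    have q: "q > 0" using p prime_gt_0_nat by (simp add: q_def)
    have qq: "int (p ^ (2 * f)) = q * q" by (simp add: q_def mult_2 power_add)
    then obtain t where "n = q * q * t" using dvd by auto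
    then obtain r where r: "n = q * r" "q dvd r" by (metis mult.assoc dvd_triv_left)
    have "f > 0" using f M by (cases f) auto
    have odd': "odd q \<or> 2 * q dvd r"
    proof (cases "odd p")
      case False
      hence "q * (2 * q) dvd q * r" using odd qq r(1) by (simp add: mult_ac)
      thus ?thesis using q by simp
    qed (simp add: q_def)
    have "admissible n q r" unfolding admissible_def
    proof (intro conjI allI impI)
      fix p' :: nat assume p': "prime p'" "int p' dvd q"
      hence "p' = p" using p unfolding q_def by (metis int_dvd_int_iff prime_dvd_power primes_dvd_imp_eq)
      show "2 * int p' dvd n \<or> odd p' \<and> int p' dvd n"
      proof (cases "odd q")
        case True
        thus ?thesis using p' r \<open>p' = p\<close> \<open>f > 0\<close> by (auto simp: q_def)
      next
        case False
        hence "2 * q dvd n" using odd' r(1) by auto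
        thus ?thesis using p'(2) by (meson dvd_trans mult_dvd_mono dvd_refl)
      qed
    qed (use r q in auto)
    moreover have "\<exists>S \<subseteq> {0..<q} \<times> {0..<q}. 2 * int (card S) + 4 \<ge> int M \<and>
       (\<forall>(k, l) \<in> S. 2 * q dvd a * twist n r k + b * twist n r l)" if ab: "a > 0" "b > 0" for a b
    proof -
      obtain S where S: "S \<subseteq> {0..<q} \<times> {0..<q}" "int (card S) = q"
        "\<And>k l. (k, l) \<in> S \<Longrightarrow> 2 * q dvd a * twist n r k + b * twist n r l"
        using integral_pairs_square[OF r(1) q r(2) odd' ab] by blast
      have "q \<ge> int M" using f unfolding q_def by (rule of_nat_mono)
      thus ?thesis using S by (intro exI[of _ S]) auto
    qed
    ultimately show ?thesis by (rule admissible_pairs)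
  qed
  have "nat n > (M ^ 4) ^ M" using n by (simp add: zless_nat_eq_int_zless)
  thus ?thesis
  proof (cases rule: large_prime_or_prime_power_divisor)
    case (1 p)
    have odd: "odd p" using 1 M prime_odd_nat by auto
    have pn: "int p dvd n" using 1(3) n0 by (metis int_dvd_int_iff int_nat_eq less_imp_le)
    then obtain r where r: "n = int p * r" by blast
    show ?thesis
    proof (cases "int p dvd r")
      case True
      \<comment> \<open>Here p^2 divides n, so the prime is handled as a prime power with f =
        1.\<close>
      thus ?thesis using square[of p 1] 1 odd r by (auto simp: power2_eq_square)
    next
      case False
      have "admissible n (int p) r" unfolding admissible_def
      proof (intro conjI allI impI)
        fix p' :: nat assume "prime p'" "int p' dvd int p"
        hence "p' = p" using 1(1) by (metis int_dvd_int_iff primes_dvd_imp_eq)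
        thus "2 * int p' dvd n \<or> odd p' \<and> int p' dvd n" using odd pn by simp
      qed (use r 1 prime_gt_0_nat in auto)
      moreover have "\<exists>S \<subseteq> {0..<int p} \<times> {0..<int p}. 2 * int (card S) + 4 \<ge> int M \<and>
         (\<forall>(k, l) \<in> S. 2 * int p dvd a * twist n r k + b * twist n r l)" for a b
      proof -
        obtain S where "S \<subseteq> {0..<int p} \<times> {0..<int p}" "2 * int (card S) + 4 \<ge> int p"
          "\<And>k l. (k, l) \<in> S \<Longrightarrow> 2 * int p dvd a * twist n r k + b * twist n r l"
          using integral_pairs_prime[OF r, of a b] 1 odd False by auto
        thus ?thesis using 1(2) by (intro exI[of _ S]) auto
      qed
      ultimately show ?thesis by (rule admissible_pairs)
    qed
  next
    case (2 p f)
    have dvd: "int (p ^ (2 * f + 1)) dvd n" using 2(3) n0 by (metis int_dvd_int_iff int_nat_eq less_imp_le)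
    have "int (p ^ (2 * f)) dvd n" using dvd by (rule dvd_trans[rotated]) simp
    moreover have "odd p \<or> int (2 * p ^ (2 * f)) dvd n"
    proof (cases "odd p")
      case False
      hence "p = 2" using 2(1) primes_dvd_imp_eq two_is_prime_nat by blast
      thus ?thesis using dvd by simp
    qed simp
    ultimately show ?thesis using square 2 by blast
  qed
qed

section \<open>Contradiction for large n\<close>

text \<open>K is the bound of \<open>card_integral_pairs_le\<close> for T = 10^24. The choice of M
  gives S at least K + 5 points; as at most four have both twists zero, some point is eligible for
  \<open>ratio_le\<close>, and then S is too large.\<close>

lemma not_represents_twists_sorted:
  assumes K: "K = (120 * 10 ^ 24 + 1) ^ 9" and bound: "int M = 2 * K + 14" and n: "n > int ((M ^ 4) ^ M)" "n \<ge> 3"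
    and abc: "0 < a" "a \<le> b" "b \<le> c"
  shows "\<not> represents_twists n a b c"
proof
  assume rep: "represents_twists n a b c"
  have "K \<ge> 0" unfolding K by (rule zero_le_power) simp
  hence "M \<ge> 3" using bound by linarith
  obtain q r where adm: "admissible n q r" and
    ex: "\<And>a b. a > 0 \<Longrightarrow> b > 0 \<Longrightarrow> \<exists>S \<subseteq> {0..<q} \<times> {0..<q}. 2 * int (card S) + 4 \<ge> int M \<and>
       (\<forall>(k, l) \<in> S. 2 * q dvd a * twist n r k + b * twist n r l)"
    using many_integral_pairs[OF \<open>M \<ge> 3\<close> n(1)] by blast
  have "0 < b" using abc by simp
  from ex[OF abc(1) this] obtain S where S: "S \<subseteq> {0..<q} \<times> {0..<q}" and card: "2 * int (card S) + 4 \<ge> int M"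
    and "\<forall>(k, l)\<in>S. 2 * q dvd a * twist n r k + b * twist n r l" by blast
  hence dvd: "\<And>k l. (k, l) \<in> S \<Longrightarrow> 2 * q dvd a * twist n r k + b * twist n r l" by blast
  have nq: "n = q * r" and q: "q > 0" using admissibleD[OF adm] by auto
  have r: "r > 0" using n(2) q nq zero_less_mult_pos[of q r] by linarith
  have card': "int (card S) > K + 4" using card unfolding bound by linarith
  \<comment> \<open>All integral roots of \<open>twist n r\<close> lie in this set.\<close>
  define Z where "Z = {0, (n - 2) div r}"
  have Z: "k \<in> Z" if "twist n r k = 0" for k
  proof -
    have "k = 0 \<or> n - 2 = r * k" using that by (auto simp: twist_def)
    thus ?thesis using r by (auto simp: Z_def)
  qed
  have "card (Z \<times> Z) \<le> 2 * 2"
    unfolding card_cartesian_product Z_def by (intro mult_mono) (auto simp: card_insert_if)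
  have "\<not> S \<subseteq> Z \<times> Z"
  proof
    assume "S \<subseteq> Z \<times> Z"
    hence "card S \<le> card (Z \<times> Z)" by (intro card_mono) (auto simp: Z_def)
    hence "int (card S) \<le> 4" using \<open>card (Z \<times> Z) \<le> 2 * 2\<close> by simp
    thus False using card' \<open>K \<ge> 0\<close> by linarith
  qed
  then obtain k l where kl: "(k, l) \<in> S" "twist n r k \<noteq> 0 \<or> twist n r l \<noteq> 0" using Z by auto
  have "b \<le> 10 ^ 24 * a"
    using S kl by (intro ratio_le[OF rep adm n(2) abc _ _ _ _ dvd[OF kl(1)] kl(2)]) auto
  hence "int (card S) \<le> K"
    unfolding K by (intro card_integral_pairs_le[OF rep adm n(2) abc _ S dvd])
  thus False using card' by simp
qed

lemma represents_twists_swap: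
  assumes "represents_twists n a b c"
  shows "represents_twists n b a c" "represents_twists n a c b"
proof -
  have rep: "\<exists>x y z. 2 * N = a * twist n n x + b * twist n n y + c * twist n n z"
    if "admissible n q r" "N \<ge> 0" "2 * q * N = a * twist n r k1 + b * twist n r k2 + c * twist n r k3"
    for q r k1 k2 k3 N
    using assms that unfolding represents_twists_def by blast
  show "represents_twists n b a c"
    unfolding represents_twists_def
  proof (intro allI impI)
    fix q r k1 k2 k3 N
    assume "admissible n q r" "N \<ge> 0" "2 * q * N = b * twist n r k1 + a * twist n r k2 + c * twist n r k3"
    hence "\<exists>x y z. 2 * N = a * twist n n x + b * twist n n y + c * twist n n z"
      by (intro rep[of q r N k2 k1 k3]) simp_all
    then obtain x y z where "2 * N = a * twist n n x + b * twist n n y + c * twist n n z" by blast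
    hence "2 * N = b * twist n n y + a * twist n n x + c * twist n n z" by simp
    thus "\<exists>x y z. 2 * N = b * twist n n x + a * twist n n y + c * twist n n z" by blast
  qed
  show "represents_twists n a c b"
    unfolding represents_twists_def
  proof (intro allI impI)
    fix q r k1 k2 k3 N
    assume "admissible n q r" "N \<ge> 0" "2 * q * N = a * twist n r k1 + c * twist n r k2 + b * twist n r k3"
    hence "\<exists>x y z. 2 * N = a * twist n n x + b * twist n n y + c * twist n n z"
      by (intro rep[of q r N k1 k3 k2]) simp_all
    then obtain x y z where "2 * N = a * twist n n x + b * twist n n y + c * twist n n z" by blast
    hence "2 * N = a * twist n n x + c * twist n n z + b * twist n n y" by simp
    thus "\<exists>x y z. 2 * N = a * twist n n x + c * twist n n y + b * twist n n z" by blast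
  qed
qed

theorem theorem1p2:
  shows "\<exists>C::real. \<forall>m::int. 3 \<le> m \<and> C < of_int m \<longrightarrow>
           \<not> (\<exists>a b c :: nat. 0 < a \<and> 0 < b \<and> 0 < c \<and>
                primitive_form [a, b, c] \<and> regular_form m [a, b, c])"
proof -
  define K :: int where "K = (120 * 10 ^ 24 + 1) ^ 9"
  define M where "M = nat (2 * K + 14)"
  have "K \<ge> 0" unfolding K_def by (rule zero_le_power) simp
  hence M: "int M = 2 * K + 14" unfolding M_def by simp
  \<comment> \<open>The summand 5 lets n = m - 2 exceed the bound and be at least 3.\<close>
  define C :: int where "C = int ((M ^ 4) ^ M) + 5"
  show ?thesis
  proof (intro exI[of _ "of_int C :: real"] allI impI notI, elim conjE exE)
    fix m :: int and a b c :: nat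
    assume "of_int C < (of_int m :: real)" and pos: "0 < a" "0 < b" "0 < c"
      and prim: "primitive_form [a, b, c]" and reg: "regular_form m [a, b, c]"
    define n where "n = m - 2"
    have "C < m" using \<open>of_int C < (of_int m :: real)\<close> by (simp only: of_int_less_iff)
    moreover have "0 \<le> int ((M ^ 4) ^ M)" by (rule of_nat_0_le_iff)
    ultimately have n: "n > int ((M ^ 4) ^ M)" "n \<ge> 3" unfolding C_def n_def by linarith+
    have rep: "represents_twists n (int a) (int b) (int c)"
      using regular_imp_represents_twists[of n a b c] reg prim pos n(2) by (simp add: n_def)
    note swap = represents_twists_swap
    \<comment> \<open>These are all six orders of the coefficients, one of which is
      increasing.\<close>
    note reps = rep swap[OF rep] swap(2)[OF swap(1)[OF rep]] swap(1)[OF swap(2)[OF rep]]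
      swap(2)[OF swap(1)[OF swap(2)[OF rep]]]
    have "\<not> (x \<le> y \<and> y \<le> z)" if "represents_twists n x y z" "0 < x" for x y z
      using not_represents_twists_sorted[OF K_def M n] that by blast
    from reps[THEN this] show False using pos by linarith
  qed
qed

end
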